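(* Let $p$ be an odd prime, let $n\ge0$ be an integer, let $F_n$ be the free pro-$p$-group on $n$ generators, and let $E$ be an open characteristic subgroup of $F_n$. Set $E_1:=\mathrm{Fr}(E)$ and $E_2:=\mho_1(E)[F_n,\mathrm{Fr}(E)]$. Then for any pro-$p$-group $G$ with $d(G)\le n$, the subgroup $E(G)$ is powerful if and only if $E_2(G)=E_1(G)$.
   Context: All homomorphisms of pro-$p$-groups are continuous, all subgroups closed, and generation is topological. $d(G)$ is the minimal number of generators of a pro-$p$-group $G$. $[A,B]$ is the closed subgroup generated by the commutators of elements of $A$ with elements of $B$; $\mho_1(G)$ is the closed subgroup generated by all $p$-th powers; $\mathrm{Fr}(G)=\mho_1(G)[G,G]$ is the Frattini subgroup. For odd $p$, a finitely generated pro-$p$-group $H$ is powerful if $\mho_1(H)=\mathrm{Fr}(H)$. A subgroup of $F_n$ is characteristic if it is invariant under all automorphisms of $F_n$. For a characteristic subgroup $E$ of $F_n$ and a pro-$p$-group $G$ with $d(G)\le n$, put $E(G):=\phi(E)$ for any surjective homomorphism $\phi\colon F_n\to G$; since $\phi$ is unique up to $\mathrm{Aut}(F_n)$, this is a characteristic subgroup of $G$ depending only on $E$ and $G$. Note that $E_1$ and $E_2$ are again characteristic (and open) in $F_n$, so that $E_1(G)$ and $E_2(G)$ are defined. *)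

theory Defs
  imports
    "HOL-Analysis.Analysis"
    "HOL-Algebra.Generated_Groups"
    "HOL-Computational_Algebra.Primes"
    "HOL-Library.Extended_Nat"
begin

section \<open>Topological groups and pro-$p$-groups\<close>

record 'a top_group = "'a monoid" +
  gtop :: "'a topology"

definition topological_group :: "('a, 'm) top_group_scheme \<Rightarrow> bool" where
  "topological_group G \<longleftrightarrow>
     group G \<and>
     topspace (gtop G) = carrier G \<and>
     continuous_map (prod_topology (gtop G) (gtop G)) (gtop G) (\<lambda>(x, y). x \<otimes>\<^bsub>G\<^esub> y) \<and>
     continuous_map (gtop G) (gtop G) (\<lambda>x. inv\<^bsub>G\<^esub> x)"

definition profinite_group :: "('a, 'm) top_group_scheme \<Rightarrow> bool" where
  "profinite_group G \<longleftrightarrow>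
     topological_group G \<and>
     compact_space (gtop G) \<and>
     Hausdorff_space (gtop G) \<and>
     (\<forall>U. openin (gtop G) U \<and> \<one>\<^bsub>G\<^esub> \<in> U \<longrightarrow>
        (\<exists>H. subgroup H G \<and> openin (gtop G) H \<and> H \<subseteq> U))"

text \<open>Open subgroups of a compact group have finite index, so \<open>card\<close> below is the true index.\<close>

definition pro_p_group :: "nat \<Rightarrow> ('a, 'm) top_group_scheme \<Rightarrow> bool" where
  "pro_p_group p G \<longleftrightarrow>
     profinite_group G \<and>
     (\<forall>N. N \<lhd> G \<and> openin (gtop G) N \<longrightarrow> (\<exists>k. card (rcosets\<^bsub>G\<^esub> N) = p ^ k))"

definition restrict_group :: "('a, 'm) top_group_scheme \<Rightarrow> 'a set \<Rightarrow> ('a, 'm) top_group_scheme"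
    (infixl "\<restriction>" 100) where
  "G \<restriction> H = G\<lparr>carrier := H, gtop := subtopology (gtop G) H\<rparr>"

definition cont_hom ::
    "('a, 'm) top_group_scheme \<Rightarrow> ('b, 'k) top_group_scheme \<Rightarrow> ('a \<Rightarrow> 'b) set" where
  "cont_hom G H = {\<phi> \<in> hom G H. continuous_map (gtop G) (gtop H) \<phi>}"

definition cont_epi ::
    "('a, 'm) top_group_scheme \<Rightarrow> ('b, 'k) top_group_scheme \<Rightarrow> ('a \<Rightarrow> 'b) set" where
  "cont_epi G H = {\<phi> \<in> cont_hom G H. \<phi> ` carrier G = carrier H}"

definition top_automorphisms :: "('a, 'm) top_group_scheme \<Rightarrow> ('a \<Rightarrow> 'a) set" where
  "top_automorphisms G = {\<alpha> \<in> iso G G. homeomorphic_map (gtop G) (gtop G) \<alpha>}"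

definition characteristic :: "'a set \<Rightarrow> ('a, 'm) top_group_scheme \<Rightarrow> bool" where
  "characteristic H G \<longleftrightarrow>
     subgroup H G \<and> closedin (gtop G) H \<and> (\<forall>\<alpha> \<in> top_automorphisms G. \<alpha> ` H = H)"


section \<open>Topological generation\<close>

definition closed_generate :: "('a, 'm) top_group_scheme \<Rightarrow> 'a set \<Rightarrow> 'a set" where
  "closed_generate G S = gtop G closure_of (generate G S)"

text \<open>The value is \<open>\<infinity>\<close> if there is no finite generating set.\<close>

definition min_generators :: "('a, 'm) top_group_scheme \<Rightarrow> enat" where
  "min_generators G =
     (INF S \<in> {S. finite S \<and> S \<subseteq> carrier G \<and> closed_generate G S = carrier G}. enat (card S))"

definition finitely_generated :: "('a, 'm) top_group_scheme \<Rightarrow> bool" where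
  "finitely_generated G \<longleftrightarrow>
     (\<exists>S. finite S \<and> S \<subseteq> carrier G \<and> closed_generate G S = carrier G)"

definition commutator_subgroup ::
    "('a, 'm) top_group_scheme \<Rightarrow> 'a set \<Rightarrow> 'a set \<Rightarrow> 'a set" where
  "commutator_subgroup G A B =
     closed_generate G {inv\<^bsub>G\<^esub> a \<otimes>\<^bsub>G\<^esub> inv\<^bsub>G\<^esub> b \<otimes>\<^bsub>G\<^esub> a \<otimes>\<^bsub>G\<^esub> b | a b. a \<in> A \<and> b \<in> B}"

definition power_subgroup :: "nat \<Rightarrow> ('a, 'm) top_group_scheme \<Rightarrow> 'a set" where
  "power_subgroup p G = closed_generate G ((\<lambda>x. x [^]\<^bsub>G\<^esub> p) ` carrier G)"

definition frattini :: "nat \<Rightarrow> ('a, 'm) top_group_scheme \<Rightarrow> 'a set" where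
  "frattini p G =
     power_subgroup p G <#>\<^bsub>G\<^esub> commutator_subgroup G (carrier G) (carrier G)"

text \<open>This is the definition for odd \<open>p\<close> only.\<close>

definition powerful :: "nat \<Rightarrow> ('a, 'm) top_group_scheme \<Rightarrow> bool" where
  "powerful p H \<longleftrightarrow>
     pro_p_group p H \<and> finitely_generated H \<and> power_subgroup p H = frattini p H"


section \<open>Free pro-$p$-groups\<close>

text \<open>
  The universal property, with free basis \<open>x 0, \<dots>, x (n - 1)\<close>.
  A definition cannot quantify over types, so the target groups have carriers of type
  \<open>nat set\<close>. Nothing is lost: a pro-\<open>p\<close>-group generated by finitely many elements has at most
  continuum many elements, hence is isomorphic to one with carrier in \<open>nat set\<close>, and every
  map from a finite set to a pro-\<open>p\<close>-group lands in such a closed subgroup.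
  Homomorphisms are taken to be \<open>undefined\<close> outside the carrier for the sake of uniqueness.
\<close>

definition free_pro_p_group :: "nat \<Rightarrow> nat \<Rightarrow> ('a, 'm) top_group_scheme \<Rightarrow> bool" where
  "free_pro_p_group p n F \<longleftrightarrow>
     pro_p_group p F \<and>
     (\<exists>x. (\<forall>i<n. x i \<in> carrier F) \<and>
       (\<forall>(H :: nat set top_group) h.
          pro_p_group p H \<and> (\<forall>i<n. h i \<in> carrier H) \<longrightarrow>
          (\<exists>!\<phi>. \<phi> \<in> cont_hom F H \<and> \<phi> \<in> extensional (carrier F) \<and> (\<forall>i<n. \<phi> (x i) = h i))))"

text \<open>
  \<open>E(G)\<close> for a characteristic subgroup \<open>E\<close> of a free pro-\<open>p\<close>-group \<open>F\<close> on \<open>n\<close> generators and a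
  pro-\<open>p\<close>-group \<open>G\<close> with at most \<open>n\<close> generators. An epimorphism \<open>F \<rightarrow> G\<close> then exists, and it is
  unique up to automorphisms of \<open>F\<close>, so that the result does not depend on the choice.
\<close>

definition char_value ::
    "('a, 'm) top_group_scheme \<Rightarrow> 'a set \<Rightarrow> ('b, 'k) top_group_scheme \<Rightarrow> 'b set" where
  "char_value F E G = (SOME \<phi>. \<phi> \<in> cont_epi F G) ` E"

end

theory Submission
  imports Defs "HOL-Algebra.Group_Action" "HOL-Algebra.Zassenhaus"
begin

text \<open>
  Let \<open>\<phi> : F \<rightarrow> G\<close> be an epimorphism and \<open>K = E(G) = \<phi> ` E\<close>, an open normal subgroup of \<open>G\<close>. Since \<open>F\<close> is
  compact, \<open>\<phi>\<close> commutes with taking generated closed subgroups, so \<open>E\<^sub>1(G) = Fr(K)\<close> and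
  \<open>E\<^sub>2(G) = P [G, Fr(K)]\<close> with \<open>P\<close> the closed subgroup generated by the \<open>p\<close>-th powers in \<open>K\<close>. If
  \<open>K\<close> is powerful, then \<open>Fr(K) = P\<close> is normal in \<open>G\<close>, hence contains \<open>[G, Fr(K)]\<close>. Conversely, if
  \<open>A = Fr(K)\<close> satisfies \<open>A = P [G, A]\<close>, then \<open>A \<subseteq> M\<close> for every open normal \<open>M \<supseteq> P\<close>, by
  induction on the index: if \<open>M'/M\<close> is the (nontrivial) centre of the finite \<open>p\<close>-group \<open>G/M\<close>, then
  \<open>A \<subseteq> M'\<close> gives \<open>[G, A] \<subseteq> M\<close>. As \<open>P\<close> is closed and normal, these \<open>M\<close> intersect in \<open>P\<close>.

  The existence of \<open>\<phi>\<close> needs a copy of \<open>G\<close> with carrier of type \<open>nat set\<close>. By Schreier's argument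
  an open subgroup of a finitely generated profinite group is the closure of a subgroup generated by
  finitely many elements of a fixed countable dense subgroup, so there are only countably many open
  subgroups, and an element is determined by its cosets modulo these.
\<close>

section \<open>Topological groups\<close>

\<comment> \<open>The notation makes the infix \<open>closure_of\<close> of topologies ambiguous.\<close>
no_notation eq_closure_of ("closure'_of\<index>")

locale topo_group = group G for G :: "('a, 'm) top_group_scheme" (structure) +
  assumes topspace_gtop [simp]: "topspace (gtop G) = carrier G"
    and continuous_mult: "continuous_map (prod_topology (gtop G) (gtop G)) (gtop G) (\<lambda>(x, y). x \<otimes> y)"
    and continuous_inv: "continuous_map (gtop G) (gtop G) (\<lambda>x. inv x)"

lemma topological_group_iff: "topological_group G \<longleftrightarrow> topo_group G"
  by (auto simp: topological_group_def topo_group_def topo_group_axioms_def)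

context topo_group
begin

lemma continuous_map_mult:
  assumes "continuous_map X (gtop G) f" "continuous_map X (gtop G) g"
  shows "continuous_map X (gtop G) (\<lambda>x. f x \<otimes> g x)"
proof -
  have "continuous_map X (prod_topology (gtop G) (gtop G)) (\<lambda>x. (f x, g x))"
    using assms by (simp add: continuous_map_paired)
  from continuous_map_compose [OF this continuous_mult] show ?thesis
    by (simp add: o_def)
qed

lemma continuous_map_r_mult: "a \<in> carrier G \<Longrightarrow> continuous_map (gtop G) (gtop G) (\<lambda>x. x \<otimes> a)"
  by (intro continuous_map_mult) auto

lemma continuous_map_conj:
  assumes "a \<in> carrier G"
  shows "continuous_map (gtop G) (gtop G) (\<lambda>x. a \<otimes> x \<otimes> inv a)"
  using assms by (intro continuous_map_mult) auto

lemma openin_r_coset: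
  assumes "openin (gtop G) U" "a \<in> carrier G"
  shows "openin (gtop G) (U #> a)"
proof -
  have U: "U \<subseteq> carrier G"
    using openin_subset [OF assms(1)] by simp
  have "U #> a = {x \<in> topspace (gtop G). x \<otimes> inv a \<in> U}"
  proof (intro equalityI subsetI)
    fix x assume "x \<in> U #> a"
    then obtain u where "u \<in> U" "x = u \<otimes> a"
      by (auto simp: r_coset_def)
    with U show "x \<in> {x \<in> topspace (gtop G). x \<otimes> inv a \<in> U}"
      using \<open>a \<in> carrier G\<close> by (auto simp: m_assoc)
  next
    fix x assume x: "x \<in> {x \<in> topspace (gtop G). x \<otimes> inv a \<in> U}"
    then have "x = (x \<otimes> inv a) \<otimes> a"
      using \<open>a \<in> carrier G\<close> by (simp add: m_assoc)
    with x show "x \<in> U #> a"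
      unfolding r_coset_def by blast
  qed
  then show ?thesis
    using openin_continuous_map_preimage [OF continuous_map_r_mult assms(1)] assms(2) by simp
qed

text \<open>The translates \<open>U #> h\<close> with \<open>h \<in> H\<close> are open and cover
  \<open>H\<close>.\<close>

lemma openin_subgroup_if_nhd:
  assumes "subgroup H G" "openin (gtop G) U" "\<one> \<in> U" "U \<subseteq> H"
  shows "openin (gtop G) H"
proof -
  interpret H: subgroup H G by fact
  have "H = (\<Union>h\<in>H. U #> h)"
  proof (intro equalityI subsetI)
    fix x assume "x \<in> H"
    moreover have "x \<in> U #> x"
      using \<open>\<one> \<in> U\<close> \<open>x \<in> H\<close> unfolding r_coset_def by force
    ultimately show "x \<in> (\<Union>h\<in>H. U #> h)" by blast
  next
    fix x assume "x \<in> (\<Union>h\<in>H. U #> h)"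
    then show "x \<in> H"
      using \<open>U \<subseteq> H\<close> by (auto simp: r_coset_def)
  qed
  moreover have "openin (gtop G) (\<Union>h\<in>H. U #> h)"
    using openin_r_coset [OF assms(2)] by (intro openin_Union) auto
  ultimately show ?thesis by simp
qed

text \<open>The complement is a union of right cosets of \<open>H\<close>, each of which is
  open.\<close>

lemma closedin_open_subgroup:
  assumes "subgroup H G" "openin (gtop G) H"
  shows "closedin (gtop G) H"
proof -
  interpret H: subgroup H G by fact
  have "carrier G - H = (\<Union>x\<in>carrier G - H. H #> x)"
  proof (intro equalityI subsetI)
    fix x assume "x \<in> carrier G - H"
    then show "x \<in> (\<Union>x\<in>carrier G - H. H #> x)"
      using rcos_self [OF _ assms(1)] by blast
  next
    fix y assume "y \<in> (\<Union>x\<in>carrier G - H. H #> x)"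
    then obtain x h where x: "x \<in> carrier G" "x \<notin> H" and h: "h \<in> H" "y = h \<otimes> x"
      by (auto simp: r_coset_def)
    have "inv h \<otimes> y = x"
      using x h by (simp add: m_assoc [symmetric])
    then have "y \<notin> H"
      using x h by (metis H.m_closed H.m_inv_closed)
    then show "y \<in> carrier G - H"
      using x h by auto
  qed
  moreover have "openin (gtop G) (\<Union>x\<in>carrier G - H. H #> x)"
    using openin_r_coset [OF assms(2)] by (intro openin_Union) auto
  ultimately show ?thesis
    using H.subset by (simp add: closedin_def)
qed

text \<open>A continuous map sends the closure of a set into the closure of its image. For products
  this is applied to multiplication on \<open>H \<times> H\<close>, whose closure is the product of
  the closures.\<close>

lemma subgroup_closure_of:
  assumes "subgroup H G"
  shows "subgroup (gtop G closure_of H) G"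
proof (rule subgroupI)
  interpret H: subgroup H G by fact
  show "gtop G closure_of H \<subseteq> carrier G"
    using closure_of_subset_topspace [of "gtop G" H] by simp
  have incl: "H \<subseteq> gtop G closure_of H"
    using H.subset by (simp add: closure_of_subset)
  then show "gtop G closure_of H \<noteq> {}"
    using H.one_closed by blast
  show "inv a \<in> gtop G closure_of H" if "a \<in> gtop G closure_of H" for a
  proof -
    have "(\<lambda>x. inv x) ` (gtop G closure_of H) \<subseteq> gtop G closure_of ((\<lambda>x. inv x) ` H)"
      by (rule continuous_map_image_closure_subset [OF continuous_inv])
    also have "\<dots> \<subseteq> gtop G closure_of H"
      by (intro closure_of_mono) auto
    finally show ?thesis using that by blast
  qed
  show "a \<otimes> b \<in> gtop G closure_of H" if "a \<in> gtop G closure_of H" "b \<in> gtop G closure_of H" for a b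
  proof -
    have "(\<lambda>(x, y). x \<otimes> y) ` (prod_topology (gtop G) (gtop G) closure_of (H \<times> H))
        \<subseteq> gtop G closure_of ((\<lambda>(x, y). x \<otimes> y) ` (H \<times> H))"
      by (rule continuous_map_image_closure_subset [OF continuous_mult])
    also have "\<dots> \<subseteq> gtop G closure_of H"
      by (intro closure_of_mono) auto
    finally have *: "(\<lambda>(x, y). x \<otimes> y) ` (prod_topology (gtop G) (gtop G) closure_of (H \<times> H))
        \<subseteq> gtop G closure_of H" .
    have "(a, b) \<in> prod_topology (gtop G) (gtop G) closure_of (H \<times> H)"
      using that by (simp add: closure_of_Times)
    then have "(\<lambda>(x, y). x \<otimes> y) (a, b) \<in> gtop G closure_of H"
      using * by blast
    then show ?thesis by simp
  qed
qed

lemma normal_closure_of: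
  assumes "N \<lhd> G"
  shows "gtop G closure_of N \<lhd> G"
proof (rule normal_invI)
  interpret N: normal N G by fact
  show "subgroup (gtop G closure_of N) G"
    by (rule subgroup_closure_of) (rule N.is_subgroup)
  fix a x assume a: "a \<in> carrier G" and x: "x \<in> gtop G closure_of N"
  have "(\<lambda>x. a \<otimes> x \<otimes> inv a) ` (gtop G closure_of N) \<subseteq> gtop G closure_of ((\<lambda>x. a \<otimes> x \<otimes> inv a) ` N)"
    by (rule continuous_map_image_closure_subset [OF continuous_map_conj [OF a]])
  also have "\<dots> \<subseteq> gtop G closure_of N"
    using N.inv_op_closed2 [OF a] by (intro closure_of_mono) auto
  finally show "a \<otimes> x \<otimes> inv a \<in> gtop G closure_of N"
    using x by blast
qed

lemma subgroup_closed_generate: "S \<subseteq> carrier G \<Longrightarrow> subgroup (closed_generate G S) G"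
  unfolding closed_generate_def by (intro subgroup_closure_of generate_is_subgroup)

lemma closed_generate_minimal:
  assumes "subgroup H G" "closedin (gtop G) H" "S \<subseteq> H"
  shows "closed_generate G S \<subseteq> H"
  unfolding closed_generate_def
  using generate_subgroup_incl [OF assms(3,1)] assms(2) by (rule closure_of_minimal)

lemma closedin_closed_generate: "closedin (gtop G) (closed_generate G S)"
  by (simp add: closed_generate_def)

lemma normal_closed_generate:
  assumes "S \<subseteq> carrier G" "\<And>h g. \<lbrakk>h \<in> S; g \<in> carrier G\<rbrakk> \<Longrightarrow> g \<otimes> h \<otimes> inv g \<in> S"
  shows "closed_generate G S \<lhd> G"
  unfolding closed_generate_def using assms by (intro normal_closure_of normal_generateI)

end

section \<open>Subgroups with the induced topology\<close>

lemma restrict_group_simps [simp]: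
  "carrier (G \<restriction> H) = H" "mult (G \<restriction> H) = mult G" "one (G \<restriction> H) = one G"
  "gtop (G \<restriction> H) = subtopology (gtop G) H"
  by (simp_all add: restrict_group_def)

text \<open>Subgroup facts are phrased for \<open>G\<lparr>carrier := H\<rparr>\<close>, which
  differs from \<open>G \<restriction> H\<close> only in the topology. The group notions ignore that
  field, so facts pass from one record to the other.\<close>

lemma group_restrict_group: "group (G \<restriction> H) \<longleftrightarrow> group (G\<lparr>carrier := H\<rparr>)"
  unfolding group_def monoid_def group_axioms_def Units_def by simp

lemma nat_pow_restrict_group [simp]: "x [^]\<^bsub>G \<restriction> H\<^esub> (n::nat) = x [^]\<^bsub>G\<^esub> n"
  unfolding nat_pow_def by simp

lemma r_coset_restrict_group [simp]: "N #>\<^bsub>G \<restriction> H\<^esub> x = N #>\<^bsub>G\<^esub> x"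
  by (simp add: r_coset_def)

lemma set_mult_restrict_group [simp]: "A <#>\<^bsub>G \<restriction> H\<^esub> B = A <#>\<^bsub>G\<^esub> B"
  by (simp add: set_mult_def)

lemma m_inv_restrict_group: "inv\<^bsub>G \<restriction> H\<^esub> x = inv\<^bsub>G\<lparr>carrier := H\<rparr>\<^esub> x"
  by (simp add: m_inv_def)

lemma subgroup_restrict_group: "subgroup K (G \<restriction> H) \<longleftrightarrow> subgroup K (G\<lparr>carrier := H\<rparr>)"
  by (simp add: subgroup_def m_inv_restrict_group)

text \<open>\<open>generate\<close> sees a record only through its unit, product and inverse. The
  inclusion is used in both directions to replace one record by another.\<close>

lemma generate_mono_structure:
  assumes "one A = one B" "mult A = mult B" "m_inv A = m_inv B"
  shows "generate A S \<subseteq> generate B S"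
proof
  fix x assume "x \<in> generate A S"
  then show "x \<in> generate B S"
    by (induction rule: generate.induct)
      (auto simp: assms intro: generate.one generate.incl generate.inv generate.eng)
qed

lemma generate_restrict_group: "generate (G \<restriction> H) S = generate (G\<lparr>carrier := H\<rparr>) S"
proof (rule equalityI; rule generate_mono_structure)
  show inv: "m_inv (G \<restriction> H) = m_inv (G\<lparr>carrier := H\<rparr>)"
    by (rule ext) (rule m_inv_restrict_group)
  show "m_inv (G\<lparr>carrier := H\<rparr>) = m_inv (G \<restriction> H)"
    by (rule inv [symmetric])
qed simp_all

context topo_group
begin

lemma inv_restrict_group [simp]:
  "subgroup H G \<Longrightarrow> x \<in> H \<Longrightarrow> inv\<^bsub>G \<restriction> H\<^esub> x = inv x"
  by (simp add: m_inv_restrict_group m_inv_consistent)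

text \<open>As \<open>H\<close> is closed, a subset of \<open>H\<close> has the same closure in the
  subspace \<open>H\<close> as in the whole group.\<close>

lemma closed_generate_restrict_group:
  assumes "subgroup H G" "closedin (gtop G) H" "S \<subseteq> H"
  shows "closed_generate (G \<restriction> H) S = closed_generate G S"
proof -
  have gen: "generate (G \<restriction> H) S = generate G S"
    using generate_consistent [OF assms(3,1)] by (simp add: generate_restrict_group)
  moreover have "generate G S \<subseteq> H"
    by (rule generate_subgroup_incl) fact+
  moreover have "gtop G closure_of generate G S \<subseteq> H"
    using assms(2) \<open>generate G S \<subseteq> H\<close> by (simp add: closure_of_minimal)
  ultimately show ?thesis
    unfolding closed_generate_def
    by (simp only: gen restrict_group_simps closure_of_subtopology Int_absorb1 Int_absorb2)
qed

lemma topo_group_restrict_group: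
  assumes "subgroup H G"
  shows "topo_group (G \<restriction> H)"
proof -
  interpret H: subgroup H G by fact
  have grp: "group (G \<restriction> H)"
    using assms by (simp add: group_restrict_group subgroup_imp_group)
  have "continuous_map (prod_topology (subtopology (gtop G) H) (subtopology (gtop G) H)) (gtop G)
      (\<lambda>(x, y). x \<otimes> y)"
    unfolding prod_topology_subtopology
    by (simp add: subtopology_subtopology continuous_map_from_subtopology continuous_mult)
  moreover have "continuous_map (subtopology (gtop G) H) (gtop G) (\<lambda>x. inv\<^bsub>G \<restriction> H\<^esub> x)"
    by (rule continuous_map_eq [OF continuous_map_from_subtopology [OF continuous_inv]])
      (use assms in auto)
  ultimately show ?thesis
    using grp assms
    by (auto simp: topo_group_def topo_group_axioms_def continuous_map_in_subtopology
        H.subset inf.absorb2)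
qed

end

section \<open>Profinite groups\<close>

lemma (in group) r_coset_mult_eq:
  assumes "subgroup H G" "x \<in> carrier G" "y \<in> carrier G"
  shows "H #> x = H #> y \<longleftrightarrow> x \<otimes> inv y \<in> H"
  by (metis assms is_group rcos_self repr_independence subgroup.rcos_module)

text \<open>Together with \<open>m_assoc\<close> these rules cancel inside products bracketed to the
  right.\<close>

lemma (in group) mult_inv_cancel_left:
  assumes "x \<in> carrier G" "y \<in> carrier G"
  shows "x \<otimes> (inv x \<otimes> y) = y" "inv x \<otimes> (x \<otimes> y) = y"
  using assms by (simp_all flip: m_assoc)

text \<open>Schreier's argument. \<open>T\<close> holds representatives of the finitely many cosets
  of \<open>H\<close> that meet \<open>D\<close>, and \<open>Y\<close> consists of the elements
  \<open>t s u^-1\<close> with \<open>t\<close> in \<open>T\<close>, \<open>s\<close> a generator or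
  its inverse, and \<open>u\<close> the representative of the coset of \<open>t s\<close>. The
  representative of \<open>H\<close> itself need not be \<open>\<one>\<close>, so
  \<open>\<one>\<close> is added to \<open>T\<close> and \<open>H \<inter> T\<close> to
  \<open>Y\<close>.\<close>

lemma (in group) finite_index_subgroup_generators:
  assumes "finite S" "S \<subseteq> carrier G" "subgroup H G" "finite (rcosets H)"
  obtains Y where "finite Y" "Y \<subseteq> generate G S" "H \<inter> generate G S = generate G Y"
proof -
  interpret H: subgroup H G by fact
  define D where "D = generate G S"
  have D: "subgroup D G"
    unfolding D_def using assms(2) by (rule generate_is_subgroup)
  interpret D: subgroup D G by (rule D)
  \<comment> \<open>Representatives are taken inside \<open>D\<close>, so that the Schreier
    generators stay in \<open>D\<close>.\<close>
  define rep where "rep X = (SOME d. d \<in> D \<and> H #> d = X)" for X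
  have rep: "rep (H #> d) \<in> D" "H #> rep (H #> d) = H #> d" if "d \<in> D" for d
    using someI [of "\<lambda>e. e \<in> D \<and> H #> e = H #> d" d] that by (auto simp: rep_def)
  define T where "T = insert \<one> (rep ` ((\<lambda>d. H #> d) ` D))"
  have "(\<lambda>d. H #> d) ` D \<subseteq> rcosets H"
    using D.subset by (auto simp: RCOSETS_def)
  then have "finite T"
    unfolding T_def using assms(4) by (simp add: finite_subset)
  have "T \<subseteq> D"
    using rep by (auto simp: T_def)
  have repT: "rep (H #> d) \<in> T" if "d \<in> D" for d
    using that by (auto simp: T_def)
  define S' where "S' = S \<union> (\<lambda>s. inv s) ` S"
  have S': "S' \<subseteq> D"
    by (auto simp: S'_def D_def intro: generate.incl generate.inv)
  define Y where "Y = (H \<inter> T) \<union> (\<lambda>(t, s). t \<otimes> s \<otimes> inv (rep (H #> (t \<otimes> s)))) ` (T \<times> S')"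
  have TSD: "t \<otimes> s \<in> D" if "t \<in> T" "s \<in> S'" for t s
    using that \<open>T \<subseteq> D\<close> S' by blast
  have "finite Y"
    using \<open>finite T\<close> assms(1) by (simp add: Y_def S'_def)
  have YD: "Y \<subseteq> D"
    using \<open>T \<subseteq> D\<close> rep TSD by (auto simp: Y_def)
  have YH: "Y \<subseteq> H"
  proof -
    have "t \<otimes> s \<otimes> inv (rep (H #> (t \<otimes> s))) \<in> H" if "t \<in> T" "s \<in> S'" for t s
      using r_coset_mult_eq [OF assms(3), of "t \<otimes> s" "rep (H #> (t \<otimes> s))"]
        rep [OF TSD [OF that]] D.mem_carrier TSD [OF that] by auto
    then show ?thesis by (auto simp: Y_def)
  qed
  have YG: "Y \<subseteq> carrier G"
    using YH by auto
  \<comment> \<open>Right multiplication by \<open>d\<close> leads from a representative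
    \<open>t\<close> to a representative \<open>u\<close>, up to a left factor generated by
    \<open>Y\<close>. The claim covers every starting point \<open>t\<close> so that the steps for
    \<open>h1\<close> and \<open>h2\<close> can be chained.\<close>
  have *: "\<forall>t\<in>T. \<exists>u\<in>T. t \<otimes> d \<otimes> inv u \<in> generate G Y" if "d \<in> D" for d
    using that unfolding D_def
  proof (induction rule: generate.induct)
    case one
    show ?case
    proof
      fix t assume "t \<in> T"
      then have "t \<otimes> \<one> \<otimes> inv t = \<one>"
        using \<open>T \<subseteq> D\<close> by auto
      then show "\<exists>u\<in>T. t \<otimes> \<one> \<otimes> inv u \<in> generate G Y"
        using \<open>t \<in> T\<close> by (metis generate.one)
    qed
  next
    case (incl h)
    then have "h \<in> S'" by (simp add: S'_def)
    show ?case
    proof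
      fix t assume "t \<in> T"
      with \<open>h \<in> S'\<close> have "t \<otimes> h \<otimes> inv (rep (H #> (t \<otimes> h))) \<in> Y"
        unfolding Y_def by (intro UnI2 image_eqI [of _ _ "(t, h)"]) auto
      then show "\<exists>u\<in>T. t \<otimes> h \<otimes> inv u \<in> generate G Y"
        using repT [OF TSD [OF \<open>t \<in> T\<close> \<open>h \<in> S'\<close>]] by (blast intro: generate.incl)
    qed
  next
    case (inv h)
    then have "inv h \<in> S'" by (simp add: S'_def)
    show ?case
    proof
      fix t assume "t \<in> T"
      with \<open>inv h \<in> S'\<close> have "t \<otimes> inv h \<otimes> inv (rep (H #> (t \<otimes> inv h))) \<in> Y"
        unfolding Y_def by (intro UnI2 image_eqI [of _ _ "(t, inv h)"]) auto
      then show "\<exists>u\<in>T. t \<otimes> inv h \<otimes> inv u \<in> generate G Y"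
        using repT [OF TSD [OF \<open>t \<in> T\<close> \<open>inv h \<in> S'\<close>]] by (blast intro: generate.incl)
    qed
  next
    case (eng h1 h2)
    show ?case
    proof
      fix t assume "t \<in> T"
      then obtain u where u: "u \<in> T" "t \<otimes> h1 \<otimes> inv u \<in> generate G Y"
        using eng.IH(1) by blast
      then obtain v where v: "v \<in> T" "u \<otimes> h2 \<otimes> inv v \<in> generate G Y"
        using eng.IH(2) by blast
      have carr: "t \<in> carrier G" "u \<in> carrier G" "v \<in> carrier G" "h1 \<in> carrier G" "h2 \<in> carrier G"
        using \<open>t \<in> T\<close> u v \<open>T \<subseteq> D\<close> eng.hyps generate_in_carrier [OF assms(2)] by auto
      have "t \<otimes> (h1 \<otimes> h2) \<otimes> inv v = (t \<otimes> h1 \<otimes> inv u) \<otimes> (u \<otimes> h2 \<otimes> inv v)"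
        using carr by (simp add: m_assoc mult_inv_cancel_left)
      then have "t \<otimes> (h1 \<otimes> h2) \<otimes> inv v \<in> generate G Y"
        using generate.eng [OF u(2) v(2)] by simp
      then show "\<exists>u\<in>T. t \<otimes> (h1 \<otimes> h2) \<otimes> inv u \<in> generate G Y"
        using v(1) by (rule rev_bexI [rotated])
    qed
  qed
  have "H \<inter> D \<subseteq> generate G Y"
  proof
    fix d assume d: "d \<in> H \<inter> D"
    \<comment> \<open>Starting at \<open>\<one>\<close>, the walk along \<open>d\<close> ends at
      some \<open>u\<close> in \<open>T\<close>. Since \<open>d\<close> and
      \<open>d \<otimes> inv u\<close> lie in \<open>H\<close>, so does \<open>u\<close>, and then
      \<open>u\<close> is itself one of the generators in \<open>Y\<close>.\<close>
    have "\<one> \<in> T" by (simp add: T_def)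
    then obtain u where u: "u \<in> T" "\<one> \<otimes> d \<otimes> inv u \<in> generate G Y"
      using * [of d] d by blast
    have "u \<in> carrier G" "d \<in> carrier G"
      using u(1) \<open>T \<subseteq> D\<close> d by auto
    with u have du: "d \<otimes> inv u \<in> generate G Y" by simp
    then have "d \<otimes> inv u \<in> H"
      using generate_subgroup_incl [OF YH assms(3)] by blast
    then have "inv (d \<otimes> inv u) \<otimes> d \<in> H"
      using d by blast
    then have "u \<in> H"
      using \<open>u \<in> carrier G\<close> \<open>d \<in> carrier G\<close> by (simp add: inv_mult_group m_assoc)
    then have "u \<in> Y"
      using u(1) by (simp add: Y_def)
    then have "(d \<otimes> inv u) \<otimes> u \<in> generate G Y"
      using du by (blast intro: generate.incl generate.eng)
    then show "d \<in> generate G Y"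
      using \<open>u \<in> carrier G\<close> \<open>d \<in> carrier G\<close> by (simp add: m_assoc)
  qed
  moreover have "generate G Y \<subseteq> H \<inter> D"
    using generate_subgroup_incl [OF YH assms(3)] generate_subgroup_incl [OF YD D] by blast
  ultimately show thesis
    using that [OF \<open>finite Y\<close>] YD unfolding D_def by blast
qed

text \<open>Every element is the product of a finite word over the countable alphabet of generators
  and their inverses.\<close>

lemma (in group) countable_generate:
  assumes "countable S" "S \<subseteq> carrier G"
  shows "countable (generate G S)"
proof -
  let ?S = "S \<union> (\<lambda>s. inv s) ` S" and ?f = "\<lambda>w. foldr (\<otimes>) w \<one>"
  have S: "?S \<subseteq> carrier G"
    using assms(2) by auto
  have closed: "?f w \<in> carrier G" if "w \<in> lists ?S" for w
    using that by induction (use S in auto)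
  have append: "?f (v @ w) = ?f v \<otimes> ?f w" if "v \<in> lists ?S" "w \<in> lists ?S" for v w
    using that(1)
  proof induction
    case Nil
    then show ?case using closed [OF that(2)] by simp
  next
    case (Cons a l)
    then show ?case
      using closed [OF that(2)] closed [of l] S by (auto simp: m_assoc subset_eq)
  qed
  have "x \<in> ?f ` lists ?S" if "x \<in> generate G S" for x
    using that
  proof (induction rule: generate.induct)
    case one
    show ?case by (rule image_eqI [of _ _ "[]"]) auto
  next
    case (incl h)
    then show ?case using S by (intro image_eqI [of _ _ "[h]"]) auto
  next
    case (inv h)
    then show ?case using S by (intro image_eqI [of _ _ "[inv h]"]) auto
  next
    case (eng h1 h2)
    then obtain v w where "v \<in> lists ?S" "w \<in> lists ?S" "h1 = ?f v" "h2 = ?f w"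
      by blast
    then show ?case
      using append by (intro image_eqI [of _ _ "v @ w"]) auto
  qed
  then have "generate G S \<subseteq> ?f ` lists ?S" by blast
  moreover have "countable (?f ` lists ?S)"
    using assms(1) by simp
  ultimately show ?thesis
    by (rule countable_subset)
qed

text \<open>The index of \<open>N\<close> in \<open>K\<close> equals that of their images in the
  quotient by \<open>M\<close>, a group of order \<open>p ^ k\<close>, so by Lagrange it divides
  \<open>p ^ k\<close>. The cosets are written as \<open>N #> x\<close> with \<open>x\<close> in
  \<open>K\<close> because these are the right cosets of \<open>N\<close> in
  \<open>G \<restriction> K\<close>.\<close>

lemma (in group) index_prime_power_subquotient:
  fixes p k :: nat
  assumes K: "subgroup K G" and N: "subgroup N G" and M: "M \<lhd> G" and "M \<subseteq> N" "N \<subseteq> K"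
    and p: "Factorial_Ring.prime p" and card: "card (rcosets M) = p ^ k"
  shows "\<exists>j. card ((\<lambda>x. N #> x) ` K) = p ^ j"
proof -
  interpret M: normal M G by fact
  interpret N: subgroup N G by fact
  interpret K: subgroup K G by fact
  interpret Q: group "G Mod M" by (rule M.factorgroup_is_group)
  define \<pi> where "\<pi> x = M #> x" for x
  have hom: "group_hom G (G Mod M) \<pi>"
    unfolding \<pi>_def by (simp add: group_hom_def group_hom_axioms_def M.r_coset_hom_Mod M.factorgroup_is_group is_group)
  have K': "subgroup (\<pi> ` K) (G Mod M)" and N': "subgroup (\<pi> ` N) (G Mod M)"
    using group_hom.subgroup_img_is_subgroup [OF hom] K N by auto
  have "card (\<pi> ` K) dvd p ^ k"
    using Q.lagrange [OF K'] card by (metis FactGroup_def dvd_triv_right order_def partial_object.select_convs(1))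
  interpret K': group "(G Mod M)\<lparr>carrier := \<pi> ` K\<rparr>"
    using K' by (rule Q.subgroup_imp_group)
  have "subgroup (\<pi> ` N) ((G Mod M)\<lparr>carrier := \<pi> ` K\<rparr>)"
    using K' N' \<open>N \<subseteq> K\<close> by (intro Q.subgroup_incl) auto
  from K'.lagrange [OF this]
  have "card (rcosets\<^bsub>(G Mod M)\<lparr>carrier := \<pi> ` K\<rparr>\<^esub> (\<pi> ` N)) * card (\<pi> ` N) = card (\<pi> ` K)"
    by (simp add: order_def)
  then have "card (rcosets\<^bsub>(G Mod M)\<lparr>carrier := \<pi> ` K\<rparr>\<^esub> (\<pi> ` N)) dvd card (\<pi> ` K)"
    by (rule dvdI [OF sym])
  then have dvd: "card (rcosets\<^bsub>(G Mod M)\<lparr>carrier := \<pi> ` K\<rparr>\<^esub> (\<pi> ` N)) dvd p ^ k"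
    using \<open>card (\<pi> ` K) dvd p ^ k\<close> by (rule dvd_trans)
  have img: "(`) \<pi> (N #> x) = \<pi> ` N #>\<^bsub>G Mod M\<^esub> \<pi> x" if "x \<in> K" for x
  proof -
    have "\<pi> (n \<otimes> x) = \<pi> n \<otimes>\<^bsub>G Mod M\<^esub> \<pi> x" if "n \<in> N" for n
      using group_hom.hom_mult [OF hom] that \<open>x \<in> K\<close> by simp
    then show ?thesis
      by (force simp: r_coset_def)
  qed
  \<comment> \<open>Taking images loses no coset: the kernel \<open>M\<close> of
    \<open>\<pi>\<close> is contained in \<open>N\<close>.\<close>
  have "bij_betw ((`) \<pi>) ((\<lambda>x. N #> x) ` K) (rcosets\<^bsub>(G Mod M)\<lparr>carrier := \<pi> ` K\<rparr>\<^esub> (\<pi> ` N))"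
  proof (rule bij_betw_imageI)
    have "(`) \<pi> ` ((\<lambda>x. N #> x) ` K) = (\<lambda>x. \<pi> ` N #>\<^bsub>G Mod M\<^esub> \<pi> x) ` K"
      by (simp add: image_image img cong: image_cong_simp)
    then show "(`) \<pi> ` ((\<lambda>x. N #> x) ` K) = rcosets\<^bsub>(G Mod M)\<lparr>carrier := \<pi> ` K\<rparr>\<^esub> (\<pi> ` N)"
      by (auto simp: RCOSETS_def)
    show "inj_on ((`) \<pi>) ((\<lambda>x. N #> x) ` K)"
    proof (rule inj_onI, clarify)
      fix x y assume xy: "x \<in> K" "y \<in> K" and eq: "\<pi> ` (N #> x) = \<pi> ` (N #> y)"
      have "x \<in> N #> x"
        using rcos_self [OF _ N] xy by auto
      then obtain n where n: "n \<in> N" "\<pi> x = \<pi> (n \<otimes> y)"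
        using eq by (auto simp: r_coset_def image_iff set_eq_iff) (metis (no_types, lifting))
      then have "x \<otimes> inv (n \<otimes> y) \<in> M"
        using xy by (auto simp: \<pi>_def r_coset_mult_eq [OF M.is_subgroup])
      then have "x \<otimes> inv (n \<otimes> y) \<otimes> n \<in> N"
        using n \<open>M \<subseteq> N\<close> by blast
      moreover have "x \<otimes> inv (n \<otimes> y) \<otimes> n = x \<otimes> inv y"
        using xy n by (simp add: inv_mult_group m_assoc)
      ultimately show "N #> x = N #> y"
        using xy by (simp add: r_coset_mult_eq [OF N])
    qed
  qed
  then have "card ((\<lambda>x. N #> x) ` K) dvd p ^ k"
    using dvd by (simp add: bij_betw_same_card)
  then show ?thesis
    using p divides_primepow_nat by blast
qed

section \<open>Open subgroups of profinite groups\<close>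

locale profinite = topo_group +
  assumes compact: "compact_space (gtop G)"
    and Hausdorff: "Hausdorff_space (gtop G)"
    and open_subgroup_base:
      "\<lbrakk>openin (gtop G) U; \<one> \<in> U\<rbrakk> \<Longrightarrow> \<exists>H. subgroup H G \<and> openin (gtop G) H \<and> H \<subseteq> U"

lemma profinite_group_iff: "profinite_group G \<longleftrightarrow> profinite G"
  by (auto simp: profinite_group_def topological_group_iff profinite_def profinite_axioms_def)

context profinite
begin

text \<open>The right cosets form an open cover by pairwise disjoint nonempty sets, so a finite
  subcover must contain all of them.\<close>

lemma finite_rcosets:
  assumes "subgroup H G" "openin (gtop G) H"
  shows "finite (rcosets H)"
proof -
  have "\<forall>U\<in>rcosets H. openin (gtop G) U" "topspace (gtop G) \<subseteq> \<Union>(rcosets H)"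
    using openin_r_coset [OF assms(2)] rcosets_part_G [OF assms(1)] by (auto simp: RCOSETS_def)
  then obtain \<F> where \<F>: "finite \<F>" "\<F> \<subseteq> rcosets H" "topspace (gtop G) \<subseteq> \<Union>\<F>"
    using compact unfolding compact_space_alt by meson
  have "X \<in> \<F>" if X: "X \<in> rcosets H" for X
  proof -
    obtain x where "x \<in> carrier G" "X = H #> x"
      using X by (auto simp: RCOSETS_def)
    then have x: "x \<in> X" "x \<in> carrier G"
      using rcos_self [OF _ assms(1)] by simp_all
    then obtain Y where "Y \<in> \<F>" "x \<in> Y"
      using \<F>(3) by auto
    have "X = Y"
    proof (rule ccontr)
      assume "X \<noteq> Y"
      then have "disjnt X Y"
        using pairwiseD [OF rcos_disjoint [OF assms(1)] X] \<F>(2) \<open>Y \<in> \<F>\<close> by blast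
      with x \<open>x \<in> Y\<close> show False
        by (auto simp: disjnt_def)
    qed
    with \<open>Y \<in> \<F>\<close> show ?thesis by simp
  qed
  then have "rcosets H \<subseteq> \<F>"
    by (rule subsetI)
  then show ?thesis
    using \<F>(1) by (rule finite_subset)
qed

text \<open>\<open>N\<close> is the intersection of the conjugates \<open>C x\<close> of
  \<open>H\<close>. Each is open, and \<open>C x\<close> depends only on the coset
  \<open>H #> x\<close>, so the intersection is finite and hence open.\<close>

lemma open_normal_core:
  assumes H: "subgroup H G" "openin (gtop G) H"
  obtains N where "N \<lhd> G" "openin (gtop G) N" "N \<subseteq> H"
proof -
  interpret H: subgroup H G by fact
  define C where "C x = {g \<in> carrier G. x \<otimes> g \<otimes> inv x \<in> H}" for x
  define N where "N = \<Inter>(C ` carrier G)"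
  have C_cong: "C x \<subseteq> C y" if xy: "x \<in> carrier G" "y \<in> carrier G" "H #> x = H #> y" for x y
  proof
    fix g assume g: "g \<in> C x"
    then have "g \<in> carrier G" by (simp add: C_def)
    have h: "x \<otimes> inv y \<in> H"
      using xy r_coset_mult_eq [OF H(1)] by simp
    moreover have "y \<otimes> g \<otimes> inv y = inv (x \<otimes> inv y) \<otimes> (x \<otimes> g \<otimes> inv x) \<otimes> (x \<otimes> inv y)"
      using xy \<open>g \<in> carrier G\<close> by (simp add: inv_mult_group m_assoc mult_inv_cancel_left)
    moreover have "inv (x \<otimes> inv y) \<otimes> (x \<otimes> g \<otimes> inv x) \<otimes> (x \<otimes> inv y) \<in> H"
      using h g by (intro H.m_closed [OF H.m_closed [OF H.m_inv_closed]]) (simp_all add: C_def)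
    ultimately show "g \<in> C y"
      using \<open>g \<in> carrier G\<close> by (simp add: C_def)
  qed
  have "C ` carrier G = (\<lambda>X. C (SOME y. y \<in> X)) ` (rcosets H)"
  proof -
    have "C (SOME y. y \<in> H #> x) = C x" if "x \<in> carrier G" for x
    proof -
      have "(SOME y. y \<in> H #> x) \<in> H #> x"
        using rcos_self [OF that H(1)] by (rule someI)
      then have "H #> x = H #> (SOME y. y \<in> H #> x)" "(SOME y. y \<in> H #> x) \<in> carrier G"
        using repr_independence [OF _ that H(1)] H.elemrcos_carrier [OF is_group that] by auto
      with that show ?thesis
        by (intro equalityI C_cong) auto
    qed
    then show ?thesis
      by (force simp: RCOSETS_def)
  qed
  then have "finite (C ` carrier G)"
    using finite_rcosets [OF H] by simp
  moreover have "openin (gtop G) (C x)" if "x \<in> carrier G" for x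
    using openin_continuous_map_preimage [OF continuous_map_conj [OF that] H(2)]
    by (simp add: C_def)
  ultimately have "openin (gtop G) N"
    unfolding N_def by (intro openin_Inter) auto
  have "N \<lhd> G"
  proof (rule normal_invI)
    have "subgroup (C x) G" if "x \<in> carrier G" for x
    proof (rule subgroupI)
      show "C x \<noteq> {}"
        using that by (auto simp: C_def intro!: exI [of _ \<one>])
      fix a assume a: "a \<in> C x"
      then have "inv (x \<otimes> a \<otimes> inv x) \<in> H" "a \<in> carrier G"
        by (auto simp: C_def)
      with that show "inv a \<in> C x"
        by (simp add: C_def inv_mult_group m_assoc)
      fix b assume b: "b \<in> C x"
      then have "(x \<otimes> a \<otimes> inv x) \<otimes> (x \<otimes> b \<otimes> inv x) \<in> H" "b \<in> carrier G"
        using a by (auto simp: C_def)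
      with that \<open>a \<in> carrier G\<close> show "a \<otimes> b \<in> C x"
        by (simp add: C_def m_assoc mult_inv_cancel_left)
    qed (auto simp: C_def)
    then show "subgroup N G"
      unfolding N_def by (intro subgroups_Inter) auto
    fix a g assume a: "a \<in> carrier G" and g: "g \<in> N"
    have "g \<in> carrier G"
      using g by (auto simp: N_def C_def)
    have "a \<otimes> g \<otimes> inv a \<in> C x" if "x \<in> carrier G" for x
    proof -
      have "g \<in> C (x \<otimes> a)"
        using g a that by (auto simp: N_def)
      then show ?thesis
        using a that \<open>g \<in> carrier G\<close> by (simp add: C_def inv_mult_group m_assoc)
    qed
    then show "a \<otimes> g \<otimes> inv a \<in> N"
      by (auto simp: N_def)
  qed
  moreover have "N \<subseteq> H"
  proof
    fix g assume "g \<in> N"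
    then have "g \<in> C \<one>" by (auto simp: N_def)
    then show "g \<in> H" by (auto simp: C_def)
  qed
  ultimately show thesis
    using that \<open>openin (gtop G) N\<close> by blast
qed

text \<open>The subgroup generated by \<open>S\<close> is dense and \<open>K\<close> is open, so
  their intersection is dense in \<open>K\<close>; Schreier's argument makes this intersection
  finitely generated.\<close>

lemma open_subgroup_generators:
  assumes S: "finite S" "S \<subseteq> carrier G" "closed_generate G S = carrier G"
    and K: "subgroup K G" "openin (gtop G) K"
  obtains Y where "finite Y" "Y \<subseteq> generate G S" "Y \<subseteq> K" "closed_generate G Y = K"
proof -
  obtain Y where Y: "finite Y" "Y \<subseteq> generate G S" "K \<inter> generate G S = generate G Y"
    using finite_index_subgroup_generators [OF S(1,2) K(1) finite_rcosets [OF K]] .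
  have "Y \<subseteq> K"
    using generate.incl [of _ Y G] Y(3) by blast
  have "K \<inter> carrier G \<subseteq> gtop G closure_of (K \<inter> generate G S)"
    using openin_Int_closure_of_subset [OF K(2), of "generate G S"] S(3)
    by (simp add: closed_generate_def)
  then have "K \<subseteq> closed_generate G Y"
    using subgroup.subset [OF K(1)] Y(3) by (auto simp: closed_generate_def)
  moreover have "closed_generate G Y \<subseteq> K"
    using closed_generate_minimal [OF K(1) closedin_open_subgroup [OF K] \<open>Y \<subseteq> K\<close>] .
  ultimately show thesis
    using that [OF Y(1,2) \<open>Y \<subseteq> K\<close>] by blast
qed

lemma ex_inj_nat_set:
  assumes S: "finite S" "S \<subseteq> carrier G" "closed_generate G S = carrier G"
  obtains f :: "'a \<Rightarrow> nat set" where "inj_on f (carrier G)"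
proof -
  define D where "D = generate G S"
  define \<O> where "\<O> = {K. subgroup K G \<and> openin (gtop G) K}"
  have D: "countable D" "D \<subseteq> carrier G"
    unfolding D_def using countable_generate [OF countable_finite [OF S(1)] S(2)] generate_incl [OF S(2)] by blast+
  have "\<O> \<subseteq> closed_generate G ` {Y. finite Y \<and> Y \<subseteq> D}"
  proof
    fix K assume "K \<in> \<O>"
    then have "subgroup K G" "openin (gtop G) K" by (simp_all add: \<O>_def)
    then obtain Y where "finite Y" "Y \<subseteq> generate G S" "closed_generate G Y = K"
      by (rule open_subgroup_generators [OF S])
    then show "K \<in> closed_generate G ` {Y. finite Y \<and> Y \<subseteq> D}"
      unfolding D_def by blast
  qed
  then have "countable \<O>"
    using countable_Collect_finite_subset [OF D(1)] by (meson countable_image countable_subset)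
  \<comment> \<open>The number coding \<open>(i, j)\<close> belongs to \<open>f x\<close> when the
    \<open>j\<close>-th element of \<open>D\<close> lies in the coset of \<open>x\<close> modulo the
    \<open>i\<close>-th open subgroup. Thus \<open>f x\<close> records the trace on \<open>D\<close>
    of every such coset.\<close>
  define f where "f x = {n. case prod_decode n of (i, j) \<Rightarrow>
      from_nat_into D j \<in> from_nat_into \<O> i #> x}" for x
  have "x = y" if x: "x \<in> carrier G" and y: "y \<in> carrier G" and eq: "f x = f y" for x y
  proof (rule ccontr)
    assume "x \<noteq> y"
    then have "x \<otimes> inv y \<noteq> \<one>"
      using x y by (metis inv_inv inv_closed inv_equality)
    moreover have "closedin (gtop G) {x \<otimes> inv y}"
      using x y Hausdorff by (simp add: closedin_Hausdorff_sing_eq)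
    then have "openin (gtop G) (carrier G - {x \<otimes> inv y})"
      by (simp add: closedin_def)
    ultimately have "\<one> \<in> carrier G - {x \<otimes> inv y}" "openin (gtop G) (carrier G - {x \<otimes> inv y})"
      by auto
    then obtain H where H: "subgroup H G" "openin (gtop G) H" "H \<subseteq> carrier G - {x \<otimes> inv y}"
      using open_subgroup_base by meson
    then have "H \<in> \<O>" by (simp add: \<O>_def)
    then obtain i where i: "from_nat_into \<O> i = H"
      using from_nat_into_surj [OF \<open>countable \<O>\<close>] by blast
    \<comment> \<open>By density the open coset \<open>H #> x\<close> contains some \<open>d\<close>
      in \<open>D\<close>. As \<open>f x = f y\<close>, this \<open>d\<close> also lies in
      \<open>H #> y\<close>, so the two cosets coincide, contrary to the choice of
      \<open>H\<close>.\<close>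
    have "x \<in> gtop G closure_of D"
      using S(3) x by (simp add: D_def closed_generate_def)
    then obtain d where d: "d \<in> D" "d \<in> H #> x"
      using openin_r_coset [OF H(2) x] rcos_self [OF x H(1)] unfolding in_closure_of by blast
    then obtain j where j: "from_nat_into D j = d"
      using from_nat_into_surj [OF D(1)] by blast
    have "prod_encode (i, j) \<in> f x"
      using d i j by (simp add: f_def)
    then have "d \<in> H #> y"
      using i j by (simp add: eq) (simp add: f_def)
    then have "H #> x = H #> y"
      using d repr_independence [OF _ _ H(1)] x y by blast
    then have "x \<otimes> inv y \<in> H"
      using r_coset_mult_eq [OF H(1)] x y by blast
    with H(3) show False by blast
  qed
  then have "inj_on f (carrier G)"
    by (rule inj_onI)
  then show thesis
    by (rule that)
qed

lemma profinite_restrict_group: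
  assumes K: "subgroup K G" "openin (gtop G) K"
  shows "profinite (G \<restriction> K)"
proof -
  have "K \<subseteq> carrier G"
    using subgroup.subset [OF K(1)] .
  have "compact_space (gtop (G \<restriction> K))"
    using closedin_compact_space [OF compact closedin_open_subgroup [OF K]] by (simp add: compact_space_subtopology)
  moreover have "Hausdorff_space (gtop (G \<restriction> K))"
    using Hausdorff by (simp add: Hausdorff_space_subtopology)
  moreover have "\<exists>H. subgroup H (G \<restriction> K) \<and> openin (gtop (G \<restriction> K)) H \<and> H \<subseteq> U"
    if U: "openin (gtop (G \<restriction> K)) U" "\<one>\<^bsub>G \<restriction> K\<^esub> \<in> U" for U
  proof -
    have "openin (gtop G) U" "U \<subseteq> K"
      using U(1) K(2) by (auto simp: openin_open_subtopology)
    then obtain H where "subgroup H G" "openin (gtop G) H" "H \<subseteq> U"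
      using open_subgroup_base [of U] U(2) by (auto simp del: openin_subtopology)
    then show ?thesis
      using K \<open>U \<subseteq> K\<close>
      by (intro exI [of _ H]) (auto simp: subgroup_restrict_group openin_open_subtopology intro!: subgroup_incl)
  qed
  ultimately show ?thesis
    using topo_group_restrict_group [OF K(1)] by (simp add: profinite_def profinite_axioms_def)
qed

end

lemma pro_p_group_iff:
  "pro_p_group p G \<longleftrightarrow>
    profinite G \<and> (\<forall>N. N \<lhd> G \<and> openin (gtop G) N \<longrightarrow> (\<exists>k. card (rcosets\<^bsub>G\<^esub> N) = p ^ k))"
  by (simp add: pro_p_group_def profinite_group_iff)

text \<open>A normal subgroup \<open>N\<close> of \<open>K\<close> need not be normal in
  \<open>G\<close>. Its index is controlled through an open subgroup \<open>M\<close> of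
  \<open>N\<close> that is normal in \<open>G\<close> and so has \<open>p\<close>-power
  index.\<close>

lemma pro_p_group_open_subgroup:
  assumes p: "Factorial_Ring.prime p" and G: "pro_p_group p G"
    and K: "subgroup K G" "openin (gtop G) K"
  shows "pro_p_group p (G \<restriction> K)"
proof -
  interpret profinite G using G by (simp add: pro_p_group_iff)
  have "\<exists>k. card (rcosets\<^bsub>G \<restriction> K\<^esub> N) = p ^ k" if N: "N \<lhd> G \<restriction> K" "openin (gtop (G \<restriction> K)) N" for N
  proof -
    have "N \<subseteq> K" "openin (gtop G) N"
      using N(2) K(2) by (auto simp: openin_open_subtopology)
    have "subgroup N G"
      using normal_imp_subgroup [OF N(1)] K(1) incl_subgroup by (simp add: subgroup_restrict_group)
    then obtain M where M: "M \<lhd> G" "openin (gtop G) M" "M \<subseteq> N"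
      using open_normal_core \<open>openin (gtop G) N\<close> by blast
    then obtain k where "card (rcosets\<^bsub>G\<^esub> M) = p ^ k"
      using G by (auto simp: pro_p_group_iff)
    from index_prime_power_subquotient [OF K(1) \<open>subgroup N G\<close> M(1,3) \<open>N \<subseteq> K\<close> p this]
    have "\<exists>j. card ((\<lambda>x. N #>\<^bsub>G\<^esub> x) ` K) = p ^ j" .
    moreover have "rcosets\<^bsub>G \<restriction> K\<^esub> N = (\<lambda>x. N #>\<^bsub>G\<^esub> x) ` K"
      by (auto simp: RCOSETS_def)
    ultimately show ?thesis by simp
  qed
  then show ?thesis
    using profinite_restrict_group [OF K] by (simp add: pro_p_group_iff)
qed

section \<open>Epimorphisms from free pro-$p$-groups\<close>

context
  fixes G :: "('a, 'm) top_group_scheme" and H :: "('b, 'k) top_group_scheme" and f :: "'a \<Rightarrow> 'b"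
  assumes H: "group H" and iso: "f \<in> iso G H" and homeo: "homeomorphic_map (gtop G) (gtop H) f"
begin

lemma profinite_iso:
  assumes "profinite G"
  shows "profinite H"
proof -
  interpret G: profinite G by fact
  interpret H: group H by (rule H)
  interpret f: group_hom G H f
    using iso G.is_group H by (auto simp: group_hom_def group_hom_axioms_def iso_def)
  obtain g where maps: "homeomorphic_maps (gtop G) (gtop H) f g"
    using homeo homeomorphic_map_maps by blast
  then have cont: "continuous_map (gtop G) (gtop H) f" "continuous_map (gtop H) (gtop G) g"
    by (auto simp: homeomorphic_maps_def)
  have H_space: "topspace (gtop H) = carrier H"
    using iso homeomorphic_imp_surjective_map [OF homeo] by (auto simp: iso_def bij_betw_def)
  have g: "g y \<in> carrier G" "f (g y) = y" if "y \<in> carrier H" for y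
    using maps that H_space by (auto simp: homeomorphic_maps_def continuous_map_def Pi_iff)
  have "topo_group H"
  proof unfold_locales
    show "topspace (gtop H) = carrier H" by (rule H_space)
    let ?P = "prod_topology (gtop H) (gtop H)"
    \<comment> \<open>On its carrier, the operations of \<open>H\<close> are those of
      \<open>G\<close> conjugated by the homeomorphism \<open>f\<close> and its inverse
      \<open>g\<close>, so continuity carries over.\<close>
    have "continuous_map ?P (gtop G) (\<lambda>z. g (fst z) \<otimes>\<^bsub>G\<^esub> g (snd z))"
      using continuous_map_compose [OF continuous_map_fst cont(2)]
        continuous_map_compose [OF continuous_map_snd cont(2)]
      by (intro G.continuous_map_mult) (simp_all add: o_def)
    from continuous_map_compose [OF this cont(1)]
    show "continuous_map ?P (gtop H) (\<lambda>(x, y). x \<otimes>\<^bsub>H\<^esub> y)"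
      by (rule continuous_map_eq) (auto simp: H_space g)
    from continuous_map_compose [OF continuous_map_compose [OF cont(2) G.continuous_inv] cont(1)]
    show "continuous_map (gtop H) (gtop H) (\<lambda>x. inv\<^bsub>H\<^esub> x)"
      by (rule continuous_map_eq) (auto simp: H_space g)
  qed
  moreover have "compact_space (gtop H)" "Hausdorff_space (gtop H)"
    using G.compact G.Hausdorff homeomorphic_compact_space homeomorphic_Hausdorff_space
      homeomorphic_map_imp_homeomorphic_space [OF homeo] by blast+
  moreover have "\<exists>K. subgroup K H \<and> openin (gtop H) K \<and> K \<subseteq> U"
    if U: "openin (gtop H) U" "\<one>\<^bsub>H\<^esub> \<in> U" for U
  proof -
    have "openin (gtop G) {x \<in> topspace (gtop G). f x \<in> U}"
      using openin_continuous_map_preimage [OF cont(1) U(1)] .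
    moreover have "\<one>\<^bsub>G\<^esub> \<in> {x \<in> topspace (gtop G). f x \<in> U}"
      using U(2) by simp
    ultimately obtain K where K: "subgroup K G" "openin (gtop G) K" "K \<subseteq> {x \<in> topspace (gtop G). f x \<in> U}"
      using G.open_subgroup_base by meson
    have "openin (gtop H) (f ` K)"
      using homeomorphic_map_openness [OF homeo] K(2) openin_subset by blast
    then show ?thesis
      using f.subgroup_img_is_subgroup [OF K(1)] K(3) by blast
  qed
  ultimately show ?thesis
    by (simp add: profinite_def profinite_axioms_def)
qed

text \<open>An open normal subgroup of \<open>H\<close> pulls back to one of \<open>G\<close>, and
  \<open>f\<close> matches the cosets of the two bijectively, so the indices agree.\<close>

lemma pro_p_group_iso:
  assumes G: "pro_p_group p G"
  shows "pro_p_group p H"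
proof -
  interpret G: profinite G using G by (simp add: pro_p_group_iff)
  interpret H: profinite H using profinite_iso G by (simp add: pro_p_group_iff)
  interpret f: group_hom G H f
    using iso G.is_group H by (auto simp: group_hom_def group_hom_axioms_def iso_def)
  have bij: "bij_betw f (carrier G) (carrier H)"
    using iso by (simp add: iso_def)
  have "\<exists>k. card (rcosets\<^bsub>H\<^esub> N) = p ^ k" if N: "N \<lhd> H" "openin (gtop H) N" for N
  proof -
    interpret N: normal N H by (rule N(1))
    define M where "M = {x \<in> carrier G. f x \<in> N}"
    have fM: "f ` M = N"
    proof
      show "N \<subseteq> f ` M"
      proof
        fix y assume "y \<in> N"
        then obtain x where "x \<in> carrier G" "y = f x"
          using bij_betw_imp_surj_on [OF bij] N.subset by (metis imageE subsetD)
        with \<open>y \<in> N\<close> show "y \<in> f ` M"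
          by (simp add: M_def)
      qed
    qed (auto simp: M_def)
    have "M \<lhd> G"
    proof (rule G.normal_invI)
      show "subgroup M G"
        by (rule G.subgroupI) (auto simp: M_def intro!: exI [of _ "\<one>\<^bsub>G\<^esub>"])
      show "x \<otimes>\<^bsub>G\<^esub> h \<otimes>\<^bsub>G\<^esub> inv\<^bsub>G\<^esub> x \<in> M" if "x \<in> carrier G" "h \<in> M" for x h
        using that N.inv_op_closed2 [of "f x" "f h"] by (simp add: M_def)
    qed
    moreover have "openin (gtop G) M"
      using openin_continuous_map_preimage [OF homeomorphic_imp_continuous_map [OF homeo] N(2)]
      by (simp add: M_def)
    ultimately obtain k where k: "card (rcosets\<^bsub>G\<^esub> M) = p ^ k"
      using G by (auto simp: pro_p_group_iff)
    have "f ` (M #>\<^bsub>G\<^esub> x) = N #>\<^bsub>H\<^esub> f x" if "x \<in> carrier G" for x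
    proof -
      have "f ` (M #>\<^bsub>G\<^esub> x) = (\<lambda>m. f m \<otimes>\<^bsub>H\<^esub> f x) ` M"
        using that by (auto simp: r_coset_def M_def image_iff)
      also have "\<dots> = N #>\<^bsub>H\<^esub> f x"
        by (auto simp: r_coset_def simp flip: fM)
      finally show ?thesis .
    qed
    then have "(`) f ` (rcosets\<^bsub>G\<^esub> M) = (\<lambda>x. N #>\<^bsub>H\<^esub> f x) ` carrier G"
      by (auto simp: RCOSETS_def image_iff)
    also have "\<dots> = rcosets\<^bsub>H\<^esub> N"
      by (auto simp: RCOSETS_def simp flip: bij_betw_imp_surj_on [OF bij])
    finally have "(`) f ` (rcosets\<^bsub>G\<^esub> M) = rcosets\<^bsub>H\<^esub> N" .
    moreover have "inj_on ((`) f) (rcosets\<^bsub>G\<^esub> M)"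
    proof (rule inj_onI)
      fix X Y assume XY: "X \<in> rcosets\<^bsub>G\<^esub> M" "Y \<in> rcosets\<^bsub>G\<^esub> M" "f ` X = f ` Y"
      moreover have "\<Union>(rcosets\<^bsub>G\<^esub> M) = carrier G"
        using \<open>M \<lhd> G\<close> by (simp add: G.rcosets_part_G normal_imp_subgroup)
      ultimately have "X \<subseteq> carrier G" "Y \<subseteq> carrier G"
        by blast+
      then show "X = Y"
        using XY(3) bij inj_on_image_eq_iff by (metis bij_betw_def)
    qed
    ultimately show ?thesis
      using k card_image by metis
  qed
  then show ?thesis
    using H.profinite_axioms by (simp add: pro_p_group_iff)
qed

end

lemma (in topo_group) ex_isomorphic_copy:
  fixes f :: "'a \<Rightarrow> 'c"
  assumes inj: "inj_on f (carrier G)"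
  obtains H :: "'c top_group" where
    "group H" "f \<in> iso G H" "homeomorphic_map (gtop G) (gtop H) f"
proof -
  define g where "g = inv_into (carrier G) f"
  have g: "g (f x) = x" if "x \<in> carrier G" for x
    using inj that by (simp add: g_def)
  define H :: "'c top_group" where
    "H = \<lparr>carrier = f ` carrier G, mult = (\<lambda>x y. f (g x \<otimes> g y)), one = f \<one>,
          gtop = pullback_topology (f ` carrier G) g (gtop G)\<rparr>"
  have hom: "f \<in> hom G H"
    by (rule homI) (auto simp: H_def g)
  \<comment> \<open>\<open>hom_imp_img_group\<close> yields a group after resetting carrier and unit
    to the images under \<open>f\<close>; here both fields already have these values.\<close>
  have "H\<lparr>carrier := f ` carrier G, one := f \<one>\<rparr> = H"
    by (simp add: H_def)
  then have "group H"
    using hom_imp_img_group [OF hom] by simp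
  moreover have "f \<in> iso G H"
    using hom inj by (simp add: iso_def bij_betw_def H_def)
  moreover have "homeomorphic_maps (gtop G) (gtop H) f g"
  proof -
    have space: "topspace (gtop H) = f ` carrier G"
      by (auto simp: H_def topspace_pullback_topology g)
    have "continuous_map (gtop G) (gtop H) f"
      unfolding H_def top_group.select_convs
    proof (rule continuous_map_pullback')
      show "continuous_map (gtop G) (gtop G) (g \<circ> f)"
        by (rule continuous_map_eq [of _ _ id]) (simp_all add: g)
    qed auto
    moreover have "continuous_map (gtop H) (gtop G) g"
      using continuous_map_pullback [of "gtop G" "gtop G" id "f ` carrier G" g] by (simp add: H_def)
    ultimately show ?thesis
      by (auto simp: homeomorphic_maps_def space g)
  qed
  then have "homeomorphic_map (gtop G) (gtop H) f"
    using homeomorphic_map_maps by blast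
  ultimately show thesis
    by (rule that)
qed

section \<open>Existence of an epimorphism from the free group\<close>

lemma min_generators_le_enatE:
  assumes "min_generators G \<le> enat n"
  obtains S where "finite S" "S \<subseteq> carrier G" "closed_generate G S = carrier G" "card S \<le> n"
proof -
  have "\<exists>S. finite S \<and> S \<subseteq> carrier G \<and> closed_generate G S = carrier G \<and> card S \<le> n"
  proof (rule ccontr)
    assume "\<not> ?thesis"
    \<comment> \<open>This also covers the case of no finite generating set, where the infimum is
      \<open>\<infinity>\<close>.\<close>
    then have "enat (Suc n) \<le> min_generators G"
      unfolding min_generators_def by (intro INF_greatest) (auto simp: not_le Suc_le_eq)
    then have "enat (Suc n) \<le> enat n"
      using assms by (rule order_trans)
    then show False by simp
  qed
  then show thesis using that by blast
qed

text \<open>The universal property speaks only of targets with carrier in \<open>nat set\<close>.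
  The map is therefore built into an isomorphic copy \<open>H\<close> of \<open>G\<close> and
  brought back by the inverse \<open>g\<close> of \<open>f\<close>.\<close>

lemma cont_epi_free_pro_p_group:
  fixes F :: "'a top_group" and G :: "'b top_group"
  assumes F: "free_pro_p_group p n F" and G: "pro_p_group p G" "min_generators G \<le> enat n"
  shows "cont_epi F G \<noteq> {}"
proof -
  interpret F: profinite F
    using F by (simp add: free_pro_p_group_def pro_p_group_iff)
  interpret G: profinite G
    using G by (simp add: pro_p_group_iff)
  obtain S where S: "finite S" "S \<subseteq> carrier G" "closed_generate G S = carrier G" "card S \<le> n"
    using min_generators_le_enatE [OF G(2)] .
  obtain f :: "'b \<Rightarrow> nat set" where f: "inj_on f (carrier G)"
    using G.ex_inj_nat_set [OF S(1-3)] .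
  obtain H :: "nat set top_group" where
    H: "group H" "f \<in> iso G H" "homeomorphic_map (gtop G) (gtop H) f"
    using G.ex_isomorphic_copy [OF f] .
  obtain g where g: "homeomorphic_maps (gtop G) (gtop H) f g"
    using H(3) homeomorphic_map_maps by blast
  have gf: "g (f x) = x" if "x \<in> carrier G" for x
    using g that by (simp add: homeomorphic_maps_def)
  obtain e where e: "bij_betw e {0..<card S} S"
    using ex_bij_betw_nat_finite [OF S(1)] by blast
  \<comment> \<open>The basis has \<open>n\<close> elements and \<open>S\<close> may have fewer; the
    surplus basis elements go to the unit.\<close>
  define s where "s i = (if i < card S then e i else \<one>\<^bsub>G\<^esub>)" for i
  have s: "s i \<in> carrier G" for i
    using bij_betwE [OF e] S(2) by (auto simp: s_def)
  have "pro_p_group p H"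
    using pro_p_group_iso [OF H G(1)] .
  moreover have "\<forall>i<n. f (s i) \<in> carrier H"
    using H(2) s by (auto simp: iso_def hom_def)
  moreover obtain x where basis: "(\<forall>i<n. x i \<in> carrier F) \<and>
      (\<forall>(H :: nat set top_group) h. pro_p_group p H \<and> (\<forall>i<n. h i \<in> carrier H) \<longrightarrow>
        (\<exists>!\<phi>. \<phi> \<in> cont_hom F H \<and> \<phi> \<in> extensional (carrier F) \<and> (\<forall>i<n. \<phi> (x i) = h i)))"
    using F [unfolded free_pro_p_group_def, THEN conjunct2] by (rule exE)
  ultimately have "\<exists>!\<phi>. \<phi> \<in> cont_hom F H \<and> \<phi> \<in> extensional (carrier F) \<and> (\<forall>i<n. \<phi> (x i) = f (s i))"
    by (intro basis [THEN conjunct2, rule_format] conjI)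
  then obtain \<phi> where \<phi>: "\<phi> \<in> cont_hom F H" "\<And>i. i < n \<Longrightarrow> \<phi> (x i) = f (s i)"
    by (auto elim!: ex1E)
  define \<psi> where "\<psi> = g \<circ> \<phi>"
  have \<phi>_img: "\<exists>a\<in>carrier G. \<phi> y = f a" if "y \<in> carrier F" for y
  proof -
    have "\<phi> y \<in> carrier H"
      using \<phi>(1) that by (auto simp: cont_hom_def intro: hom_in_carrier)
    then show ?thesis
      using H(2) by (auto simp: iso_def bij_betw_def)
  qed
  have hom: "\<psi> \<in> hom F G"
  proof (rule homI)
    show "\<psi> y \<in> carrier G" if "y \<in> carrier F" for y
      using \<phi>_img [OF that] gf by (auto simp: \<psi>_def)
    fix y z assume yz: "y \<in> carrier F" "z \<in> carrier F"
    obtain a b where ab: "a \<in> carrier G" "b \<in> carrier G" "\<phi> y = f a" "\<phi> z = f b"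
      using \<phi>_img [OF yz(1)] \<phi>_img [OF yz(2)] by blast
    have "\<phi> (y \<otimes>\<^bsub>F\<^esub> z) = f a \<otimes>\<^bsub>H\<^esub> f b"
      using \<phi>(1) yz ab by (simp add: cont_hom_def hom_def)
    also have "\<dots> = f (a \<otimes>\<^bsub>G\<^esub> b)"
      using H(2) ab by (simp add: iso_def hom_def)
    finally show "\<psi> (y \<otimes>\<^bsub>F\<^esub> z) = \<psi> y \<otimes>\<^bsub>G\<^esub> \<psi> z"
      using ab gf by (simp add: \<psi>_def)
  qed
  have cont: "continuous_map (gtop F) (gtop G) \<psi>"
    unfolding \<psi>_def using \<phi>(1) g
    by (intro continuous_map_compose [where X' = "gtop H"]) (auto simp: cont_hom_def homeomorphic_maps_def)
  interpret \<psi>: group_hom F G \<psi>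
    using hom by (simp add: group_hom_def group_hom_axioms_def F.is_group G.is_group)
  have "S \<subseteq> \<psi> ` carrier F"
  proof
    fix t assume "t \<in> S"
    then obtain i where i: "i < card S" "e i = t"
      using bij_betw_imp_surj_on [OF e] by (metis atLeastLessThan_iff imageE)
    then have "\<psi> (x i) = t"
      using \<phi>(2) [of i] S(2,4) \<open>t \<in> S\<close> gf [of t] by (auto simp: \<psi>_def s_def)
    then show "t \<in> \<psi> ` carrier F"
      using basis i S(4) by (intro image_eqI [of _ _ "x i"]) auto
  qed
  \<comment> \<open>The image is compact, hence closed; a closed subgroup containing the topological
    generators \<open>S\<close> is all of \<open>G\<close>.\<close>
  moreover have "closedin (gtop G) (\<psi> ` carrier F)"
    using image_compactin [OF _ cont, of "carrier F"] F.compact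
    by (intro compactin_imp_closedin G.Hausdorff) (simp add: compact_space_def)
  ultimately have "carrier G \<subseteq> \<psi> ` carrier F"
    using G.closed_generate_minimal [OF \<psi>.img_is_subgroup, of S] S(3) by simp
  then have "\<psi> \<in> cont_epi F G"
    using hom cont by (auto simp: cont_epi_def cont_hom_def)
  then show ?thesis by blast
qed

section \<open>Nilpotency of finite $p$-quotients\<close>

definition center :: "('a, 'm) monoid_scheme \<Rightarrow> 'a set" where
  "center G = {z \<in> carrier G. \<forall>g \<in> carrier G. g \<otimes>\<^bsub>G\<^esub> z = z \<otimes>\<^bsub>G\<^esub> g}"

lemma (in group) normal_center: "center G \<lhd> G"
proof (rule normal_invI)
  have comm: "g \<otimes> z = z \<otimes> g" if "z \<in> center G" "g \<in> carrier G" for g z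
    using that by (simp add: center_def)
  have carr: "z \<in> carrier G" if "z \<in> center G" for z
    using that by (simp add: center_def)
  show "subgroup (center G) G"
  proof (rule subgroupI)
    show "center G \<subseteq> carrier G" by (auto simp: center_def)
    have "\<one> \<in> center G" by (simp add: center_def)
    then show "center G \<noteq> {}" by blast
    fix a assume a: "a \<in> center G"
    have "g \<otimes> inv a = inv a \<otimes> g" if "g \<in> carrier G" for g
    proof -
      have "inv a \<otimes> (a \<otimes> g) \<otimes> inv a = inv a \<otimes> (g \<otimes> a) \<otimes> inv a"
        using comm [OF a that] by simp
      then show ?thesis
        using that carr [OF a] by (simp add: m_assoc mult_inv_cancel_left)
    qed
    then show "inv a \<in> center G"
      using carr [OF a] by (simp add: center_def)
    fix b assume b: "b \<in> center G"
    have "g \<otimes> (a \<otimes> b) = a \<otimes> b \<otimes> g" if "g \<in> carrier G" for g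
    proof -
      have "g \<otimes> (a \<otimes> b) = a \<otimes> (g \<otimes> b)"
        using that carr [OF a] carr [OF b] comm [OF a that] by (simp flip: m_assoc)
      also have "\<dots> = a \<otimes> b \<otimes> g"
        using that carr [OF a] carr [OF b] comm [OF b that] by (simp add: m_assoc)
      finally show ?thesis .
    qed
    then show "a \<otimes> b \<in> center G"
      using carr [OF a] carr [OF b] by (simp add: center_def)
  qed
  show "x \<otimes> h \<otimes> inv x \<in> center G" if "x \<in> carrier G" "h \<in> center G" for x h
  proof -
    have "x \<otimes> h \<otimes> inv x = h"
      using that(1) carr [OF that(2)] comm [OF that(2,1)] by (simp add: m_assoc)
    with that show ?thesis by simp
  qed
qed

text \<open>The class equation: the orbit of \<open>\<one>\<close> under conjugation contributes 1
  to \<open>p ^ k\<close>, so some other orbit has size prime to \<open>p\<close>. Orbit sizes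
  divide \<open>p ^ k\<close>, so that orbit is a single central element.\<close>

lemma (in group) center_prime_power_order:
  assumes p: "Factorial_Ring.prime p" and order: "order G = p ^ k" and "k > 0"
  obtains z where "z \<in> center G" "z \<noteq> \<one>"
proof -
  define \<phi> where "\<phi> = (\<lambda>g. (\<lambda>h \<in> carrier G. g \<otimes> h \<otimes> (inv g)))"
  interpret group_action G "carrier G" \<phi>
    unfolding \<phi>_def by (rule action_by_conjugation)
  have "order G > 0"
    using order p by (simp add: prime_gt_0_nat)
  then have fin: "finite (carrier G)"
    by (simp add: order_gt_0_iff_finite)
  let ?\<O> = "orbits G (carrier G) \<phi>"
  have fin_orbits: "finite ?\<O>"
    using fin by (simp add: orbits_def setcompr_eq_image)
  have orbit_one: "orbit G \<phi> \<one> = {\<one>}"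
    using orbit_refl [OF one_closed] by (auto simp: orbit_def \<phi>_def)
  then have one: "{\<one>} \<in> ?\<O>"
    unfolding orbits_def by (metis (mono_tags, lifting) mem_Collect_eq one_closed)
  have "(\<Sum>X\<in>?\<O>. card X) = p ^ k"
    using disjoint_sum [OF fin, of "\<lambda>_. 1::nat"] order by (simp add: order_def)
  then have sum: "1 + (\<Sum>X\<in>?\<O> - {{\<one>}}. card X) = p ^ k"
    using sum.remove [OF fin_orbits one, of card] by simp
  have "\<exists>X\<in>?\<O> - {{\<one>}}. \<not> p dvd card X"
  proof (rule ccontr)
    assume "\<not> ?thesis"
    then have "p dvd (\<Sum>X\<in>?\<O> - {{\<one>}}. card X)"
      by (intro dvd_sum) blast
    moreover have "p dvd p ^ k"
      using \<open>k > 0\<close> by (simp add: dvd_power)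
    ultimately have "p dvd 1"
      using sum by (metis dvd_add_left_iff)
    with p show False
      by (simp add: prime_nat_iff)
  qed
  then obtain z where z: "z \<in> carrier G" "orbit G \<phi> z \<noteq> {\<one>}" "\<not> p dvd card (orbit G \<phi> z)"
    by (auto simp: orbits_def)
  have "card (orbit G \<phi> z) dvd p ^ k"
    using orbit_stabilizer_theorem [OF z(1)] order by (metis dvd_triv_left)
  then obtain j where "card (orbit G \<phi> z) = p ^ j"
    using p divides_primepow_nat by blast
  with z(3) have "card (orbit G \<phi> z) = 1"
    by (cases j) auto
  then have orbit: "orbit G \<phi> z = {z}"
    using orbit_refl [OF z(1)] by (auto simp: card_1_singleton_iff)
  have "g \<otimes> z = z \<otimes> g" if "g \<in> carrier G" for g
  proof -
    have "\<phi> g z \<in> orbit G \<phi> z"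
      using that by (auto simp: orbit_def)
    then have "g \<otimes> z \<otimes> inv g = z"
      using z(1) orbit by (simp add: \<phi>_def)
    then show ?thesis
      using z(1) that by (metis inv_solve_right' m_closed)
  qed
  then have "z \<in> center G"
    using z(1) by (simp add: center_def)
  moreover have "z \<noteq> \<one>"
    using z(2) orbit by auto
  ultimately show thesis
    by (rule that)
qed

text \<open>The map sending \<open>X\<close> to \<open>N <#> X\<close> takes the cosets of
  \<open>M\<close> onto those of \<open>N\<close>. It is not injective, as it identifies
  \<open>M\<close> with \<open>M #> z\<close> for \<open>z\<close> in \<open>N\<close> outside
  \<open>M\<close>.\<close>

lemma (in group) card_rcosets_less:
  assumes M: "subgroup M G" "finite (rcosets M)" and N: "subgroup N G" and "M \<subset> N"
  shows "card (rcosets N) < card (rcosets M)"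
proof -
  have sub: "M \<subseteq> carrier G" "N \<subseteq> carrier G"
    using M N by (simp_all add: subgroup.subset)
  have "N <#> M = N"
  proof
    show "N <#> M \<subseteq> N"
      using \<open>M \<subset> N\<close> N by (auto simp: set_mult_def subgroup.m_closed)
    show "N \<subseteq> N <#> M"
      using subgroup.one_closed [OF M(1)] sub by (force simp: set_mult_def)
  qed
  then have map: "N <#> (M #> x) = N #> x" if "x \<in> carrier G" for x
    using setmult_rcos_assoc [OF sub(2,1) that] by simp
  have image: "(\<lambda>X. N <#> X) ` (rcosets M) = rcosets N"
    unfolding RCOSETS_def using map by (auto simp: image_iff)
  obtain z where z: "z \<in> N" "z \<notin> M"
    using \<open>M \<subset> N\<close> by blast
  have "\<not> inj_on (\<lambda>X. N <#> X) (rcosets M)"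
  proof
    assume "inj_on (\<lambda>X. N <#> X) (rcosets M)"
    moreover have "N <#> (M #> z) = N <#> (M #> \<one>)"
      using z(1) sub(2) map [of z] coset_join2 [OF _ N, of z] \<open>N <#> M = N\<close> sub(1) by auto
    moreover have "M #> z \<in> rcosets M" "M #> \<one> \<in> rcosets M"
      using z sub by (auto simp del: coset_mult_one intro!: rcosetsI)
    ultimately have "M #> z = M #> \<one>"
      by (rule inj_onD)
    then have "z \<otimes> inv \<one> \<in> M"
      using r_coset_mult_eq [OF M(1), of z \<one>] z sub by auto
    with z sub show False by auto
  qed
  then show ?thesis
    using image M(2) by (metis card_image_le eq_card_imp_inj_on nat_less_le)
qed

lemma (in group_hom) normal_vimage:
  assumes "N \<lhd> H"
  shows "{x \<in> carrier G. h x \<in> N} \<lhd> G"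
proof (rule G.normal_invI)
  interpret N: normal N H by fact
  have "\<one> \<in> {x \<in> carrier G. h x \<in> N}" by simp
  then show "subgroup {x \<in> carrier G. h x \<in> N} G"
    by (intro G.subgroupI) auto
  show "x \<otimes> y \<otimes> inv x \<in> {x \<in> carrier G. h x \<in> N}"
    if "x \<in> carrier G" "y \<in> {x \<in> carrier G. h x \<in> N}" for x y
    using that N.inv_op_closed2 [of "h x" "h y"] by simp
qed

text \<open>Since \<open>B\<close> is closed, some open normal \<open>N\<close> satisfies
  \<open>g \<otimes> x \<notin> B\<close> for all \<open>g\<close> in \<open>N\<close>. The product
  of \<open>N\<close> and \<open>B\<close> is then the required subgroup:
  \<open>x = n \<otimes> b\<close> would put \<open>inv n \<otimes> x\<close> into
  \<open>B\<close>.\<close>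

lemma (in profinite) separating_open_normal:
  assumes B: "B \<lhd> G" "closedin (gtop G) B" and x: "x \<in> carrier G" "x \<notin> B"
  obtains M where "M \<lhd> G" "openin (gtop G) M" "B \<subseteq> M" "x \<notin> M"
proof -
  interpret B: normal B G by fact
  define U where "U = {g \<in> topspace (gtop G). g \<otimes> x \<in> carrier G - B}"
  have "openin (gtop G) (carrier G - B)"
    using B(2) by (simp add: closedin_def)
  then have "openin (gtop G) U"
    unfolding U_def by (rule openin_continuous_map_preimage [OF continuous_map_r_mult [OF x(1)]])
  moreover have "\<one> \<in> U"
    using x by (simp add: U_def)
  ultimately obtain H where H: "subgroup H G" "openin (gtop G) H" "H \<subseteq> U"
    using open_subgroup_base by meson
  obtain N where N: "N \<lhd> G" "openin (gtop G) N" "N \<subseteq> H"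
    using open_normal_core [OF H(1,2)] .
  interpret N: normal N G by (rule N(1))
  have sub: "subgroup (N <#> B) G"
    using mult_norm_subgroup [OF N(1) B.is_subgroup] .
  have "N <#> B \<lhd> G"
  proof (rule normal_invI [OF sub])
    fix a y assume a: "a \<in> carrier G" and "y \<in> N <#> B"
    then obtain n b where nb: "n \<in> N" "b \<in> B" "y = n \<otimes> b"
      by (auto simp: set_mult_def)
    have "a \<otimes> y \<otimes> inv a = (a \<otimes> n \<otimes> inv a) \<otimes> (a \<otimes> b \<otimes> inv a)"
      using a nb by (simp add: m_assoc mult_inv_cancel_left)
    then show "a \<otimes> y \<otimes> inv a \<in> N <#> B"
      using N.inv_op_closed2 [OF a nb(1)] B.inv_op_closed2 [OF a nb(2)] by (auto simp: set_mult_def)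
  qed
  moreover have NM: "N \<subseteq> N <#> B"
  proof
    fix n assume "n \<in> N"
    then have "n \<otimes> \<one> \<in> N <#> B"
      using B.one_closed unfolding set_mult_def by blast
    with \<open>n \<in> N\<close> show "n \<in> N <#> B" by simp
  qed
  moreover have "B \<subseteq> N <#> B"
  proof
    fix b assume "b \<in> B"
    then have "\<one> \<otimes> b \<in> N <#> B"
      using N.one_closed unfolding set_mult_def by blast
    with \<open>b \<in> B\<close> show "b \<in> N <#> B" by simp
  qed
  moreover have "openin (gtop G) (N <#> B)"
    using openin_subgroup_if_nhd [OF sub N(2) _ NM] by simp
  moreover have "x \<notin> N <#> B"
  proof
    assume "x \<in> N <#> B"
    then obtain n b where nb: "n \<in> N" "b \<in> B" "x = n \<otimes> b"
      by (auto simp: set_mult_def)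
    then have "inv n \<otimes> x = b"
      by (simp add: mult_inv_cancel_left)
    moreover have "inv n \<in> U"
      using nb(1) N(3) H(3) by blast
    ultimately show False
      using nb(2) by (simp add: U_def)
  qed
  ultimately show thesis
    using that by blast
qed

lemma pro_p_subset_open_normal:
  fixes G :: "('a, 'm) top_group_scheme" (structure)
  assumes p: "Factorial_Ring.prime p" and G: "pro_p_group p G"
    and A: "A \<subseteq> carrier G" "A \<subseteq> B <#>\<^bsub>G\<^esub> commutator_subgroup G (carrier G) A"
  shows "\<lbrakk>M \<lhd> G; openin (gtop G) M; B \<subseteq> M\<rbrakk> \<Longrightarrow> A \<subseteq> M"
proof (induction "card (rcosets\<^bsub>G\<^esub> M)" arbitrary: M rule: less_induct)
  case less
  interpret profinite G using G by (simp add: pro_p_group_iff)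
  interpret M: normal M G by (rule less.prems)
  interpret Q: group "G Mod M" by (rule M.factorgroup_is_group)
  show ?case
  proof (cases "M = carrier G")
    case True
    then show ?thesis using A(1) by simp
  next
    case False
    obtain k where k: "card (rcosets M) = p ^ k"
      using G less.prems by (auto simp: pro_p_group_iff)
    have hom: "group_hom G (G Mod M) (\<lambda>x. M #> x)"
      by (simp add: group_hom_def group_hom_axioms_def M.r_coset_hom_Mod is_group M.factorgroup_is_group)
    interpret \<pi>: group_hom G "G Mod M" "\<lambda>x. M #> x" by (rule hom)
    have order: "order (G Mod M) = p ^ k"
      using k by (simp add: order_def FactGroup_def)
    \<comment> \<open>A nontrivial centre needs a nontrivial quotient, which is why
      \<open>M = carrier G\<close> is a separate case.\<close>
    have "k > 0"
    proof (rule ccontr)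
      assume "\<not> k > 0"
      then have "carrier (G Mod M) = {M}"
        using order Q.order_one_triv_iff by simp
      then have "M #> x = M" if "x \<in> carrier G" for x
        using \<pi>.hom_closed [OF that] by simp
      then show False
        using False rcos_self [OF _ M.is_subgroup] M.subset by blast
    qed
    then obtain z where z: "z \<in> center (G Mod M)" "z \<noteq> M"
      using Q.center_prime_power_order [OF p order] by auto
    \<comment> \<open>The preimage of the centre of the quotient is strictly larger than
      \<open>M\<close>, so its index is smaller and the induction hypothesis applies to it.\<close>
    define M' where "M' = {x \<in> carrier G. M #> x \<in> center (G Mod M)}"
    have M': "M' \<lhd> G"
      unfolding M'_def by (rule \<pi>.normal_vimage [OF Q.normal_center])
    have "z \<in> carrier (G Mod M)"
      using z(1) by (simp add: center_def)
    then obtain x where x: "x \<in> carrier G" "z = M #> x"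
      by (auto simp: carrier_FactGroup)
    have "M \<subseteq> M'"
    proof
      fix y assume "y \<in> M"
      then have "M #> y = \<one>\<^bsub>G Mod M\<^esub>"
        by (simp add: coset_join2 M.is_subgroup)
      moreover have "\<one>\<^bsub>G Mod M\<^esub> \<in> center (G Mod M)"
        using normal_imp_subgroup [OF Q.normal_center] by (rule subgroup.one_closed)
      ultimately show "y \<in> M'"
        using \<open>y \<in> M\<close> by (simp add: M'_def)
    qed
    moreover have "x \<in> M'" "x \<notin> M"
      using x z coset_join2 [OF x(1) M.is_subgroup] by (auto simp: M'_def)
    ultimately have "M \<subset> M'" by blast
    then have "card (rcosets M') < card (rcosets M)"
      using card_rcosets_less M.is_subgroup finite_rcosets less.prems(2) normal_imp_subgroup [OF M']
      by blast
    moreover have "openin (gtop G) M'"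
      using openin_subgroup_if_nhd [OF normal_imp_subgroup [OF M'] less.prems(2) M.one_closed \<open>M \<subseteq> M'\<close>] .
    ultimately have "A \<subseteq> M'"
      using less.hyps [OF _ M'] less.prems(3) \<open>M \<subseteq> M'\<close> by blast
    \<comment> \<open>Modulo \<open>M\<close> the element \<open>b\<close> is central, so its
      commutator with \<open>a\<close> vanishes there.\<close>
    have "inv a \<otimes> inv b \<otimes> a \<otimes> b \<in> M" if "a \<in> carrier G" "b \<in> A" for a b
    proof -
      have b: "b \<in> carrier G" "M #> b \<in> center (G Mod M)"
        using \<open>A \<subseteq> M'\<close> that by (auto simp: M'_def)
      then have "(M #> a) \<otimes>\<^bsub>G Mod M\<^esub> (M #> b) = (M #> b) \<otimes>\<^bsub>G Mod M\<^esub> (M #> a)"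
        using \<pi>.hom_closed [OF that(1)] by (simp add: center_def del: mult_FactGroup)
      then have "M #> (a \<otimes> b) = M #> (b \<otimes> a)"
        using \<pi>.hom_mult that b by simp
      then have "M #> (inv (b \<otimes> a) \<otimes> (a \<otimes> b)) = M #> \<one>"
        using \<pi>.hom_mult [of "inv (b \<otimes> a)"] that b by (metis inv_closed l_inv m_closed)
      then have "inv (b \<otimes> a) \<otimes> (a \<otimes> b) \<in> M"
        using that b r_coset_mult_eq [OF M.is_subgroup, of "inv (b \<otimes> a) \<otimes> (a \<otimes> b)" \<one>] by simp
      then show ?thesis
        using that b by (simp add: inv_mult_group m_assoc)
    qed
    then have "commutator_subgroup G (carrier G) A \<subseteq> M"
      unfolding commutator_subgroup_def
      using closedin_open_subgroup [OF M.is_subgroup less.prems(2)]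
      by (intro closed_generate_minimal [OF M.is_subgroup]) auto
    then have "B <#> commutator_subgroup G (carrier G) A \<subseteq> M"
      using less.prems(3) by (auto simp: set_mult_def)
    with A(2) show ?thesis
      by (rule subset_trans)
  qed
qed

lemma pro_p_subset_closed_normal:
  assumes "Factorial_Ring.prime p" "pro_p_group p G"
    and A: "A \<subseteq> carrier G" "A \<subseteq> B <#>\<^bsub>G\<^esub> commutator_subgroup G (carrier G) A"
    and B: "B \<lhd> G" "closedin (gtop G) B"
  shows "A \<subseteq> B"
proof
  interpret profinite G using assms(2) by (simp add: pro_p_group_iff)
  fix x assume "x \<in> A"
  show "x \<in> B"
  proof (rule ccontr)
    assume "x \<notin> B"
    then obtain M where "M \<lhd> G" "openin (gtop G) M" "B \<subseteq> M" "x \<notin> M"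
      using separating_open_normal [OF B] A(1) \<open>x \<in> A\<close> by blast
    then show False
      using pro_p_subset_open_normal [OF assms(1-4)] \<open>x \<in> A\<close> by blast
  qed
qed

section \<open>Images of open characteristic subgroups\<close>

lemma (in group) conj_hom:
  assumes "a \<in> carrier G"
  shows "group_hom G G (\<lambda>x. a \<otimes> x \<otimes> inv a)"
  using assms
  by (auto simp: group_hom_def group_hom_axioms_def is_group m_assoc mult_inv_cancel_left intro!: homI)

text \<open>Conjugation by \<open>inv a\<close> is a continuous inverse. It follows that invariance
  under topological automorphisms includes normality.\<close>

lemma (in topo_group) conj_top_automorphism:
  assumes a: "a \<in> carrier G"
  shows "(\<lambda>x. a \<otimes> x \<otimes> inv a) \<in> top_automorphisms G"
proof -
  have "homeomorphic_maps (gtop G) (gtop G) (\<lambda>x. a \<otimes> x \<otimes> inv a) (\<lambda>x. inv a \<otimes> x \<otimes> inv (inv a))"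
    using a continuous_map_conj [OF a] continuous_map_conj [of "inv a"]
    by (simp add: homeomorphic_maps_def m_assoc mult_inv_cancel_left)
  then have homeo: "homeomorphic_map (gtop G) (gtop G) (\<lambda>x. a \<otimes> x \<otimes> inv a)"
    using homeomorphic_map_maps by blast
  then have "bij_betw (\<lambda>x. a \<otimes> x \<otimes> inv a) (carrier G) (carrier G)"
    using homeomorphic_imp_injective_map homeomorphic_imp_surjective_map
    by (fastforce simp: bij_betw_def)
  then show ?thesis
    using homeo group_hom.homh [OF conj_hom [OF a]] by (simp add: top_automorphisms_def iso_def)
qed

lemma (in topo_group) normal_characteristic:
  assumes "characteristic H G"
  shows "H \<lhd> G"
proof (rule normal_invI)
  show "subgroup H G"
    using assms by (simp add: characteristic_def)
  show "x \<otimes> h \<otimes> inv x \<in> H" if "x \<in> carrier G" "h \<in> H" for x h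
  proof -
    have "(\<lambda>y. x \<otimes> y \<otimes> inv x) ` H = H"
      using assms conj_top_automorphism [OF that(1)] by (simp add: characteristic_def)
    with that(2) show ?thesis by blast
  qed
qed

section \<open>Power, commutator and Frattini subgroups of closed subgroups\<close>

context topo_group
begin

lemma closedin_carrier: "closedin (gtop G) (carrier G)"
  using closedin_topspace [of "gtop G"] by simp

lemma power_subgroup_restrict_group:
  assumes "subgroup H G" "closedin (gtop G) H"
  shows "power_subgroup p (G \<restriction> H) = closed_generate G ((\<lambda>x. x [^] p) ` H)"
proof -
  have "(\<lambda>x. x [^] p) ` H \<subseteq> H"
    using subgroup_int_pow_closed [OF assms(1), of _ "int p"] by (auto simp: int_pow_int)
  then show ?thesis
    using closed_generate_restrict_group [OF assms] by (simp add: power_subgroup_def)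
qed

lemma commutator_subgroup_restrict_group:
  assumes "subgroup H G" "closedin (gtop G) H"
  shows "commutator_subgroup (G \<restriction> H) H H = commutator_subgroup G H H"
proof -
  interpret H: subgroup H G by (rule assms(1))
  have "{inv\<^bsub>G \<restriction> H\<^esub> a \<otimes> inv\<^bsub>G \<restriction> H\<^esub> b \<otimes> a \<otimes> b | a b. a \<in> H \<and> b \<in> H}
      = {inv a \<otimes> inv b \<otimes> a \<otimes> b | a b. a \<in> H \<and> b \<in> H}"
    using assms(1) by (metis (no_types, lifting) inv_restrict_group)
  moreover have "{inv a \<otimes> inv b \<otimes> a \<otimes> b | a b. a \<in> H \<and> b \<in> H} \<subseteq> H"
    by auto
  ultimately show ?thesis
    using closed_generate_restrict_group [OF assms] by (simp add: commutator_subgroup_def)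
qed

lemma frattini_restrict_group:
  assumes "subgroup H G" "closedin (gtop G) H"
  shows "frattini p (G \<restriction> H) = power_subgroup p (G \<restriction> H) <#> commutator_subgroup G H H"
  using commutator_subgroup_restrict_group [OF assms] by (simp add: frattini_def)

lemma power_subgroup_subset:
  assumes "subgroup H G" "closedin (gtop G) H"
  shows "power_subgroup p (G \<restriction> H) \<subseteq> H"
  unfolding power_subgroup_restrict_group [OF assms]
  using subgroup_int_pow_closed [OF assms(1), of _ "int p"]
  by (intro closed_generate_minimal assms) (auto simp: int_pow_int)

lemma commutator_subgroup_subset:
  assumes "subgroup H G" "closedin (gtop G) H"
    and "\<And>a b. \<lbrakk>a \<in> A; b \<in> B\<rbrakk> \<Longrightarrow> inv a \<otimes> inv b \<otimes> a \<otimes> b \<in> H"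
  shows "commutator_subgroup G A B \<subseteq> H"
  unfolding commutator_subgroup_def
  by (intro closed_generate_minimal assms) (use assms(3) in auto)

lemma frattini_subset:
  assumes "subgroup H G" "closedin (gtop G) H"
  shows "frattini p (G \<restriction> H) \<subseteq> H"
proof -
  interpret H: subgroup H G by (rule assms(1))
  have "commutator_subgroup G H H \<subseteq> H"
    by (rule commutator_subgroup_subset [OF assms]) auto
  then have "frattini p (G \<restriction> H) \<subseteq> H <#> H"
    unfolding frattini_restrict_group [OF assms]
    by (intro mono_set_mult power_subgroup_subset assms)
  then show ?thesis
    using subgroup_mult_id [OF assms(1)] by simp
qed

text \<open>A conjugate of \<open>x [^] p\<close> is the \<open>p\<close>-th power of the conjugate
  of \<open>x\<close>, so the generating set is already invariant under conjugation.\<close>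

lemma normal_power_subgroup:
  assumes "H \<lhd> G" "closedin (gtop G) H"
  shows "power_subgroup p (G \<restriction> H) \<lhd> G"
proof -
  interpret H: normal H G by fact
  show ?thesis
    unfolding power_subgroup_restrict_group [OF H.is_subgroup assms(2)]
  proof (rule normal_closed_generate)
    show "(\<lambda>x. x [^] p) ` H \<subseteq> carrier G"
      by auto
    fix h g assume "h \<in> (\<lambda>x. x [^] p) ` H" and g: "g \<in> carrier G"
    then obtain x where x: "x \<in> H" "h = x [^] p"
      by blast
    then have "g \<otimes> h \<otimes> inv g = (g \<otimes> x \<otimes> inv g) [^] p"
      using group_hom.hom_nat_pow [OF conj_hom [OF g], of x p] by simp
    then show "g \<otimes> h \<otimes> inv g \<in> (\<lambda>x. x [^] p) ` H"
      using H.inv_op_closed2 [OF g x(1)] by blast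
  qed
qed

end

section \<open>Continuous epimorphisms of profinite groups\<close>

locale profinite_epi = F: profinite F + G: profinite G
  for F :: "('a, 'm) top_group_scheme" and G :: "('b, 'k) top_group_scheme" +
  fixes \<phi>
  assumes epi: "\<phi> \<in> cont_epi F G"
begin

sublocale \<phi>: group_hom F G \<phi>
  using epi by (simp add: group_hom_def group_hom_axioms_def F.is_group G.is_group cont_epi_def cont_hom_def)

lemma surj: "\<phi> ` carrier F = carrier G"
  using epi by (simp add: cont_epi_def)

lemma cont: "continuous_map (gtop F) (gtop G) \<phi>"
  using epi by (simp add: cont_epi_def cont_hom_def)

lemma closed_map: "closed_map (gtop F) (gtop G) \<phi>"
  using cont F.compact G.Hausdorff by (rule continuous_imp_closed_map)

text \<open>Continuity puts the image of the closure into the closure of the image. The reverse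
  inclusion holds because \<open>\<phi>\<close>, being continuous from a compact to a Hausdorff
  space, is a closed map.\<close>

lemma image_closed_generate:
  assumes "S \<subseteq> carrier F"
  shows "\<phi> ` closed_generate F S = closed_generate G (\<phi> ` S)"
proof -
  have "generate F S \<subseteq> topspace (gtop F)"
    using F.generate_incl [OF assms] by simp
  then have "\<phi> ` (gtop F closure_of generate F S) = gtop G closure_of (\<phi> ` generate F S)"
    using continuous_map_image_closure_subset [OF cont] closed_map
    by (intro equalityI) (auto simp: closed_map_closure_of_image)
  then show ?thesis
    using \<phi>.generate_img [OF assms] by (simp add: closed_generate_def)
qed

lemma image_commutator_subgroup:
  assumes "A \<subseteq> carrier F" "B \<subseteq> carrier F"
  shows "\<phi> ` commutator_subgroup F A B = commutator_subgroup G (\<phi> ` A) (\<phi> ` B)"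
proof -
  let ?C = "{inv\<^bsub>F\<^esub> a \<otimes>\<^bsub>F\<^esub> inv\<^bsub>F\<^esub> b \<otimes>\<^bsub>F\<^esub> a \<otimes>\<^bsub>F\<^esub> b | a b. a \<in> A \<and> b \<in> B}"
  have comm: "\<phi> (inv\<^bsub>F\<^esub> a \<otimes>\<^bsub>F\<^esub> inv\<^bsub>F\<^esub> b \<otimes>\<^bsub>F\<^esub> a \<otimes>\<^bsub>F\<^esub> b)
      = inv\<^bsub>G\<^esub> \<phi> a \<otimes>\<^bsub>G\<^esub> inv\<^bsub>G\<^esub> \<phi> b \<otimes>\<^bsub>G\<^esub> \<phi> a \<otimes>\<^bsub>G\<^esub> \<phi> b" if "a \<in> A" "b \<in> B" for a b
    using that assms by (simp add: subset_eq)
  have "\<phi> ` ?C = {inv\<^bsub>G\<^esub> a \<otimes>\<^bsub>G\<^esub> inv\<^bsub>G\<^esub> b \<otimes>\<^bsub>G\<^esub> a \<otimes>\<^bsub>G\<^esub> b | a b. a \<in> \<phi> ` A \<and> b \<in> \<phi> ` B}"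
  proof (intro equalityI subsetI)
    fix y assume "y \<in> \<phi> ` ?C"
    then show "y \<in> {inv\<^bsub>G\<^esub> a \<otimes>\<^bsub>G\<^esub> inv\<^bsub>G\<^esub> b \<otimes>\<^bsub>G\<^esub> a \<otimes>\<^bsub>G\<^esub> b | a b. a \<in> \<phi> ` A \<and> b \<in> \<phi> ` B}"
      using comm by blast
  next
    fix y assume "y \<in> {inv\<^bsub>G\<^esub> a \<otimes>\<^bsub>G\<^esub> inv\<^bsub>G\<^esub> b \<otimes>\<^bsub>G\<^esub> a \<otimes>\<^bsub>G\<^esub> b | a b. a \<in> \<phi> ` A \<and> b \<in> \<phi> ` B}"
    then obtain a b where ab: "a \<in> A" "b \<in> B" "y = inv\<^bsub>G\<^esub> \<phi> a \<otimes>\<^bsub>G\<^esub> inv\<^bsub>G\<^esub> \<phi> b \<otimes>\<^bsub>G\<^esub> \<phi> a \<otimes>\<^bsub>G\<^esub> \<phi> b"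
      by blast
    then show "y \<in> \<phi> ` ?C"
      unfolding ab(3) comm [OF ab(1,2), symmetric] by (intro imageI) blast
  qed
  moreover have "?C \<subseteq> carrier F"
    using assms by (auto simp: subset_eq)
  ultimately show ?thesis
    by (simp add: commutator_subgroup_def image_closed_generate)
qed

context
  fixes E assumes E: "E \<lhd> F" "openin (gtop F) E"
begin

lemma image_normal: "\<phi> ` E \<lhd> G"
proof (rule G.normal_invI)
  interpret E: normal E F by (rule E(1))
  show "subgroup (\<phi> ` E) G"
    by (rule \<phi>.subgroup_img_is_subgroup) (rule E.is_subgroup)
  fix x h assume "x \<in> carrier G" "h \<in> \<phi> ` E"
  then obtain y e where ye: "y \<in> carrier F" "x = \<phi> y" "e \<in> E" "h = \<phi> e"
    using surj by blast
  then have "x \<otimes>\<^bsub>G\<^esub> h \<otimes>\<^bsub>G\<^esub> inv\<^bsub>G\<^esub> x = \<phi> (y \<otimes>\<^bsub>F\<^esub> e \<otimes>\<^bsub>F\<^esub> inv\<^bsub>F\<^esub> y)"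
    by simp
  then show "x \<otimes>\<^bsub>G\<^esub> h \<otimes>\<^bsub>G\<^esub> inv\<^bsub>G\<^esub> x \<in> \<phi> ` E"
    using E.inv_op_closed2 [OF ye(1,3)] by blast
qed

lemma image_open: "openin (gtop G) (\<phi> ` E)"
proof -
  interpret E: normal E F by (rule E(1))
  have "subgroup {x \<in> carrier F. \<phi> x \<in> \<phi> ` E} F"
    using \<phi>.normal_vimage [OF image_normal] by (rule normal_imp_subgroup)
  moreover have "E \<subseteq> {x \<in> carrier F. \<phi> x \<in> \<phi> ` E}"
    using E.subset by blast
  ultimately have "openin (gtop F) {x \<in> topspace (gtop F). \<phi> x \<in> \<phi> ` E}"
    using F.openin_subgroup_if_nhd [OF _ E(2) E.one_closed] by (simp only: F.topspace_gtop)
  moreover have "quotient_map (gtop F) (gtop G) \<phi>"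
    using cont closed_map surj by (intro continuous_closed_imp_quotient_map) simp_all
  moreover have "\<phi> ` E \<subseteq> topspace (gtop G)"
    using E.subset surj by auto
  ultimately show ?thesis
    unfolding quotient_map_def by blast
qed

lemma image_power_subgroup: "\<phi> ` power_subgroup p (F \<restriction> E) = power_subgroup p (G \<restriction> (\<phi> ` E))"
proof -
  interpret E: normal E F by (rule E(1))
  have "\<phi> ` (\<lambda>x. x [^]\<^bsub>F\<^esub> p) ` E = (\<lambda>x. x [^]\<^bsub>G\<^esub> p) ` \<phi> ` E"
    using \<phi>.hom_nat_pow E.subset by (force simp: image_iff)
  moreover have "(\<lambda>x. x [^]\<^bsub>F\<^esub> p) ` E \<subseteq> carrier F"
    by auto
  ultimately show ?thesis
    using F.power_subgroup_restrict_group [OF E.is_subgroup] G.power_subgroup_restrict_group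
      F.closedin_open_subgroup [OF E.is_subgroup E(2)]
      G.closedin_open_subgroup [OF _ image_open] normal_imp_subgroup [OF image_normal]
    by (simp add: image_closed_generate)
qed

lemma image_frattini: "\<phi> ` frattini p (F \<restriction> E) = frattini p (G \<restriction> (\<phi> ` E))"
proof -
  interpret E: normal E F by (rule E(1))
  have closed: "closedin (gtop F) E"
    by (rule F.closedin_open_subgroup) (use E in \<open>auto simp: E.is_subgroup\<close>)
  have "power_subgroup p (F \<restriction> E) \<subseteq> carrier F"
    using F.power_subgroup_subset [OF E.is_subgroup closed] E.subset by blast
  moreover have "commutator_subgroup F E E \<subseteq> carrier F"
    using E.subset by (intro F.commutator_subgroup_subset F.subgroup_self F.closedin_carrier) auto
  ultimately have "\<phi> ` frattini p (F \<restriction> E)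
      = power_subgroup p (G \<restriction> (\<phi> ` E)) <#>\<^bsub>G\<^esub> commutator_subgroup G (\<phi> ` E) (\<phi> ` E)"
    using F.frattini_restrict_group [OF E.is_subgroup closed] E.subset
    by (simp add: set_mult_hom [OF \<phi>.homh] image_power_subgroup image_commutator_subgroup)
  also have "\<dots> = frattini p (G \<restriction> (\<phi> ` E))"
    using G.closedin_open_subgroup [OF _ image_open] normal_imp_subgroup [OF image_normal]
    by (simp add: G.frattini_restrict_group)
  finally show ?thesis .
qed

end

end

text \<open>This is the criterion expressed in \<open>G\<close> alone; the theorem follows once the
  images under the epimorphism have been identified.\<close>

lemma powerful_open_normal_iff:
  fixes G :: "('a, 'm) top_group_scheme" (structure)
  assumes p: "Factorial_Ring.prime p" and G: "pro_p_group p G" "finitely_generated G"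
    and K: "K \<lhd> G" "openin (gtop G) K"
  shows "powerful p (G \<restriction> K) \<longleftrightarrow>
    power_subgroup p (G \<restriction> K) <#> commutator_subgroup G (carrier G) (frattini p (G \<restriction> K))
      = frattini p (G \<restriction> K)"
proof -
  interpret profinite G using G(1) by (simp add: pro_p_group_iff)
  interpret K: normal K G by (rule K(1))
  define P where "P = power_subgroup p (G \<restriction> K)"
  define \<Phi> where "\<Phi> = frattini p (G \<restriction> K)"
  have closed: "closedin (gtop G) K"
    using K.is_subgroup K(2) by (rule closedin_open_subgroup)
  have P: "P \<lhd> G" "closedin (gtop G) P" "P \<subseteq> K"
    unfolding P_def using normal_power_subgroup [OF K(1) closed] power_subgroup_subset [OF K.is_subgroup closed]
    by (simp_all add: power_subgroup_restrict_group [OF K.is_subgroup closed] closedin_closed_generate)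
  interpret P: normal P G by (rule P(1))
  have \<Phi>: "\<Phi> = P <#> commutator_subgroup G K K"
    using frattini_restrict_group [OF K.is_subgroup closed] by (simp add: \<Phi>_def P_def)
  have "\<Phi> \<subseteq> K"
    unfolding \<Phi>_def by (rule frattini_subset [OF K.is_subgroup closed])
  have left: "P \<subseteq> P <#> C" if "\<one> \<in> C" for C
    using that by (force simp: set_mult_def)
  have one_comm: "\<one> \<in> commutator_subgroup G A B" if "A \<subseteq> carrier G" "B \<subseteq> carrier G" for A B
    unfolding commutator_subgroup_def using that
    by (intro subgroup.one_closed [OF subgroup_closed_generate]) (auto simp: subset_eq)
  have "P \<subseteq> \<Phi>"
    unfolding \<Phi> by (intro left one_comm) auto
  \<comment> \<open>\<open>powerful\<close> also demands that \<open>K\<close> be a finitely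
    generated pro-\<open>p\<close>-group. Both properties pass to open subgroups, which leaves the
    equation \<open>P = \<Phi>\<close>.\<close>
  obtain S where S: "finite S" "S \<subseteq> carrier G" "closed_generate G S = carrier G"
    using G(2) by (auto simp: finitely_generated_def)
  obtain Y where Y: "finite Y" "Y \<subseteq> K" "closed_generate G Y = K"
    using open_subgroup_generators [OF S K.is_subgroup K(2)] by metis
  then have "finitely_generated (G \<restriction> K)"
    unfolding finitely_generated_def
    using closed_generate_restrict_group [OF K.is_subgroup closed Y(2)] by (intro exI [of _ Y]) simp
  then have "powerful p (G \<restriction> K) \<longleftrightarrow> P = \<Phi>"
    using pro_p_group_open_subgroup [OF p G(1) K.is_subgroup K(2)] by (simp add: powerful_def P_def \<Phi>_def)
  also have "\<dots> \<longleftrightarrow> P <#> commutator_subgroup G (carrier G) \<Phi> = \<Phi>"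
  proof
    assume eq: "P = \<Phi>"
    \<comment> \<open>The commutator is the conjugate of \<open>inv b\<close> by
      \<open>inv a\<close>, times \<open>b\<close>; both factors lie in the normal subgroup
      \<open>P\<close>.\<close>
    have "inv a \<otimes> inv b \<otimes> a \<otimes> b \<in> P" if "a \<in> carrier G" "b \<in> P" for a b
      using that P.inv_op_closed2 [of "inv a" "inv b"] by auto
    then have "commutator_subgroup G (carrier G) P \<subseteq> P"
      by (intro commutator_subgroup_subset P.is_subgroup P(2))
    then have "P <#> commutator_subgroup G (carrier G) P \<subseteq> P"
      by (auto simp: set_mult_def)
    moreover have "P \<subseteq> P <#> commutator_subgroup G (carrier G) P"
      by (intro left one_comm) auto
    ultimately show "P <#> commutator_subgroup G (carrier G) \<Phi> = \<Phi>"
      unfolding eq [symmetric] by blast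
  next
    assume "P <#> commutator_subgroup G (carrier G) \<Phi> = \<Phi>"
    \<comment> \<open>The nilpotency argument with \<open>A = \<Phi>\<close> and
      \<open>B = P\<close>, which is closed and normal in \<open>G\<close>.\<close>
    then have "\<Phi> \<subseteq> P"
      using pro_p_subset_closed_normal [OF p G(1) _ _ P(1,2)] \<open>\<Phi> \<subseteq> K\<close> K.subset by blast
    with \<open>P \<subseteq> \<Phi>\<close> show "P = \<Phi>" by blast
  qed
  finally show ?thesis
    by (simp add: P_def \<Phi>_def)
qed

theorem proposition3p4:
  fixes p n :: nat
    and F :: "'a top_group" and E E\<^sub>1 E\<^sub>2 :: "'a set"
    and G :: "'b top_group"
  assumes "Factorial_Ring.prime p" and "odd p"
    and "free_pro_p_group p n F"
    and "characteristic E F" and "openin (gtop F) E"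
    and "E\<^sub>1 = frattini p (F \<restriction> E)"
    and "E\<^sub>2 = power_subgroup p (F \<restriction> E)
               <#>\<^bsub>F\<^esub> commutator_subgroup F (carrier F) (frattini p (F \<restriction> E))"
    and "pro_p_group p G" and "min_generators G \<le> enat n"
  shows "powerful p (G \<restriction> char_value F E G) \<longleftrightarrow> char_value F E\<^sub>2 G = char_value F E\<^sub>1 G"
proof -
  interpret F: profinite F
    using assms(3) by (simp add: free_pro_p_group_def pro_p_group_iff)
  interpret G: profinite G
    using assms(8) by (simp add: pro_p_group_iff)
  define \<phi> where "\<phi> = (SOME \<phi>. \<phi> \<in> cont_epi F G)"
  \<comment> \<open>Since an epimorphism exists, the choice made by \<open>SOME\<close> is one. The
    same \<open>\<phi>\<close> computes \<open>char_value\<close> for \<open>E\<close>,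
    \<open>E\<^sub>1\<close> and \<open>E\<^sub>2\<close>.\<close>
  have "\<phi> \<in> cont_epi F G"
    unfolding \<phi>_def using cont_epi_free_pro_p_group [OF assms(3,8,9)] by (rule some_in_eq [THEN iffD2])
  then interpret profinite_epi F G \<phi>
    by unfold_locales
  have char_value: "char_value F H G = \<phi> ` H" for H
    by (simp add: char_value_def \<phi>_def)
  have E: "E \<lhd> F"
    using assms(4) by (rule F.normal_characteristic)
  interpret E: normal E F by (rule E)
  have closed: "closedin (gtop F) E"
    using E.is_subgroup assms(5) by (rule F.closedin_open_subgroup)
  have power: "power_subgroup p (F \<restriction> E) \<subseteq> E"
    by (rule F.power_subgroup_subset [OF E.is_subgroup closed])
  have frat: "frattini p (F \<restriction> E) \<subseteq> carrier F"
    using F.frattini_subset [OF E.is_subgroup closed] E.subset by blast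
  have "commutator_subgroup F (carrier F) (frattini p (F \<restriction> E)) \<subseteq> carrier F"
    using frat by (intro F.commutator_subgroup_subset F.subgroup_self F.closedin_carrier) auto
  then have "\<phi> ` E\<^sub>2 = power_subgroup p (G \<restriction> (\<phi> ` E))
      <#>\<^bsub>G\<^esub> commutator_subgroup G (carrier G) (frattini p (G \<restriction> (\<phi> ` E)))"
    using power frat E.subset unfolding assms(7)
    by (simp add: set_mult_hom [OF \<phi>.homh] image_commutator_subgroup image_power_subgroup [OF E assms(5)]
        image_frattini [OF E assms(5)] surj subset_trans [of _ E])
  moreover have "\<phi> ` E\<^sub>1 = frattini p (G \<restriction> (\<phi> ` E))"
    unfolding assms(6) by (rule image_frattini [OF E assms(5)])
  moreover have "finitely_generated G"
    using min_generators_le_enatE [OF assms(9)] unfolding finitely_generated_def by metis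
  ultimately show ?thesis
    using powerful_open_normal_iff [OF assms(1,8) _ image_normal [OF E assms(5)] image_open [OF E assms(5)]]
    by (simp add: char_value)
qed

end
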